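(* Suppose $n \in \mathbb{N}$ is not a multiple of $4$. Then $$\mathscr{S}(n) = \{T \in \mathbb{Z} : T \equiv n \pmod{2} \text{ and } |T| \le 2\sqrt{n}\},$$ where $\mathscr{S}(n)$ denotes the set of all values $a+b+c+d$ with $a,b,c,d\in\mathbb{Z}$ and $a^2+b^2+c^2+d^2=n$.
   Context: $\mathbb{N}$ denotes the set of nonnegative integers. For an integer $n$, the sum spectrum of $n$ is the set $\mathscr{S}(n) = \{a+b+c+d : a,b,c,d \in \mathbb{Z},\ a^2+b^2+c^2+d^2 = n\}$. *)

theory Defs
  imports Complex_Main "HOL-Number_Theory.Cong"
begin

definition sum_spectrum :: "int \<Rightarrow> int set" where
  "sum_spectrum n = {a + b + c + d | a b c d. a\<^sup>2 + b\<^sup>2 + c\<^sup>2 + d\<^sup>2 = n}"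

end

theory Submission
  imports Defs "HOL-Number_Theory.Number_Theory" "HOL-Analysis.Summation_Tests"
    "HOL-Computational_Algebra.Squarefree"
begin

text \<open>
  If \<open>n = a\<^sup>2 + b\<^sup>2 + c\<^sup>2 + d\<^sup>2\<close> and \<open>T = a + b + c + d\<close>, then \<open>4 n - T\<^sup>2\<close> is the sum of the squares of
  \<open>a + b - c - d\<close>, \<open>a - b + c - d\<close> and \<open>a - b - c + d\<close>. This gives the bound on \<open>T\<close>. Conversely, an
  expression of \<open>4 n - T\<^sup>2\<close> as \<open>x\<^sup>2 + y\<^sup>2 + z\<^sup>2\<close> can be inverted to integers \<open>a, b, c, d\<close> once
  \<open>x, y, z\<close> satisfy some parity conditions. For odd \<open>n\<close> the number \<open>4 n - T\<^sup>2\<close> is congruent to 3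
  modulo 8, which forces \<open>x, y, z\<close> to be odd, and the sign of \<open>x\<close> is free. For \<open>n\<close> congruent to 2
  modulo 4 one writes \<open>n - (T / 2)\<^sup>2\<close>, which is congruent to 1 or 2 modulo 4, as a sum of three
  squares and doubles. So everything rests on the theorem of Legendre and Gauss
  (\<open>sum_of_three_squares\<close>) for these residue classes.

  To write a squarefree \<open>m\<close> as a sum of three squares it suffices to find \<open>B > 0\<close> coprime to \<open>m\<close> such
  that \<open>-m\<close> is a square modulo \<open>B\<close> and \<open>-B\<close> is a square modulo \<open>m\<close>
  (\<open>three_squares_of_mutual_residues\<close>): from such a \<open>B\<close> one constructs a positive definite integral
  ternary form of determinant 1 that represents \<open>m\<close>, and by reduction theory every such form is
  equivalent to \<open>x\<^sup>2 + y\<^sup>2 + z\<^sup>2\<close> (\<open>ternary_form_det_one\<close>). Take \<open>B = c N\<close>, where \<open>c\<close> is 2 if \<open>m\<close> is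
  congruent to 3 modulo 8 and 1 otherwise, and \<open>N\<close> is squarefree. The conditions on \<open>N\<close> are then that
  its Legendre symbols at the odd primes dividing \<open>m\<close> have prescribed values, and that every prime
  factor \<open>l\<close> of \<open>N\<close> satisfies \<open>\<omega> l = 1\<close>, where \<open>\<omega>\<close> is the real character that agrees with the symbol
  \<open>(-m / l)\<close> by quadratic reciprocity.

  A prime \<open>N\<close> could be taken from Dirichlet's theorem on arithmetic progressions; composite \<open>N\<close> need
  much less (\<open>exists_squarefree_with_characters\<close>). Let \<open>r n\<close> be the sum of \<open>\<omega> d\<close> over the divisors \<open>d\<close> of
  \<open>n\<close>. It is nonnegative, it is at least 1 on squares, and it vanishes if a prime with \<open>\<omega> p = -1\<close>
  divides \<open>n\<close> to an odd power. The sum of \<open>r n / sqrt n\<close> over \<open>n \<le> Y\<^sup>2\<close> coprime to the modulus is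
  unbounded, because the squares already contribute a harmonic sum. For a real character \<open>\<psi>\<close> the
  product \<open>r \<psi>\<close> is the Dirichlet convolution of \<open>\<omega> \<psi>\<close> and \<open>\<psi>\<close>, and when both of these are nontrivial the
  hyperbola method shows that the sum of \<open>r n * \<psi> n / sqrt n\<close> stays bounded
  (\<open>dirichlet_convolution_bound\<close>). Detecting the prescribed character values by products of the \<open>\<psi>\<close>
  therefore leaves a divergent sum, so some \<open>n\<close> with \<open>r n \<noteq> 0\<close> has the prescribed values, and \<open>N\<close> is its
  squarefree part.
\<close>

section \<open>Reduction of integral ternary forms of determinant one\<close>

lemma exists_centered_residue:
  fixes a t :: int
  assumes "a > 0"
  shows "\<exists>k. 2 * \<bar>t + k * a\<bar> \<le> a"
proof -
  define k where "k = - ((2 * t + a) div (2 * a))"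
  have "2 * t + a = (2 * t + a) div (2 * a) * (2 * a) + (2 * t + a) mod (2 * a)"
    by (metis div_mult_mod_eq)
  moreover have "0 \<le> (2 * t + a) mod (2 * a)" "(2 * t + a) mod (2 * a) < 2 * a"
    using assms by simp_all
  ultimately have "2 * \<bar>t + k * a\<bar> \<le> a"
    unfolding k_def by (simp add: algebra_simps abs_if)
  thus ?thesis by blast
qed

text \<open>
  Lagrange reduction of the form with coefficients \<open>p, 2 q, r\<close>: translate until \<open>2 \<bar>q\<bar> \<le> p\<close>, and
  exchange the two variables as long as this makes the first coefficient smaller. At the end
  \<open>p \<le> r\<close>, and \<open>3 p\<^sup>2 \<le> 4 D\<close> follows from \<open>p\<^sup>2 \<le> p r = D + q\<^sup>2\<close>. The column \<open>(\<alpha>, \<gamma>)\<close> of the unimodular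
  substitution is the vector at which the reduced first coefficient is attained.
\<close>

lemma binary_form_reduction:
  fixes p q r D :: int
  assumes "p > 0" "p * r - q\<^sup>2 = D" "D > 0"
  shows "\<exists>\<alpha> \<beta> \<gamma> \<delta>. \<alpha> * \<delta> - \<beta> * \<gamma> = 1 \<and> p * \<alpha>\<^sup>2 + 2 * q * \<alpha> * \<gamma> + r * \<gamma>\<^sup>2 > 0 \<and>
           3 * (p * \<alpha>\<^sup>2 + 2 * q * \<alpha> * \<gamma> + r * \<gamma>\<^sup>2)\<^sup>2 \<le> 4 * D"
  using assms
proof (induction "nat p" arbitrary: p q r rule: less_induct)
  case less
  obtain k where k: "2 * \<bar>q + k * p\<bar> \<le> p"
    using exists_centered_residue[OF less.prems(1)] by blast
  define q' where "q' = q + k * p"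
  define r' where "r' = r + 2 * q * k + p * k\<^sup>2"
  have D: "p * r' - q'\<^sup>2 = D"
    using less.prems(2) unfolding q'_def r'_def by (simp add: algebra_simps power2_eq_square)
  have "\<bar>2 * q'\<bar>\<^sup>2 \<le> p\<^sup>2" using k less.prems(1) unfolding q'_def abs_mult by (intro power_mono) auto
  hence q'2: "4 * q'\<^sup>2 \<le> p\<^sup>2" by (simp add: power_mult_distrib)
  have "p * r' > 0" using D less.prems(3) by (smt (verit) zero_le_power2)
  hence r'pos: "r' > 0" using less.prems(1) by (simp add: zero_less_mult_iff)
  show ?case
  proof (cases "p \<le> r'")
    case True
    hence "p\<^sup>2 \<le> p * r'" using less.prems(1) by (simp add: power2_eq_square)
    hence "3 * p\<^sup>2 \<le> 4 * D" using D q'2 by linarith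
    thus ?thesis using less.prems(1)
      by (intro exI[of _ 1] exI[of _ 0] exI[of _ 0] exI[of _ 1]) simp
  next
    case False
    have "r' * p - (- q')\<^sup>2 = D" using D by (simp add: mult.commute)
    from less.hyps[OF _ r'pos this less.prems(3)] False r'pos
    obtain \<alpha> \<beta> \<gamma> \<delta> where u: "\<alpha> * \<delta> - \<beta> * \<gamma> = 1"
      "r' * \<alpha>\<^sup>2 + 2 * (- q') * \<alpha> * \<gamma> + p * \<gamma>\<^sup>2 > 0"
      "3 * (r' * \<alpha>\<^sup>2 + 2 * (- q') * \<alpha> * \<gamma> + p * \<gamma>\<^sup>2)\<^sup>2 \<le> 4 * D" by auto
    have eq: "p * (k * \<alpha> - \<gamma>)\<^sup>2 + 2 * q * (k * \<alpha> - \<gamma>) * \<alpha> + r * \<alpha>\<^sup>2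
              = r' * \<alpha>\<^sup>2 + 2 * (- q') * \<alpha> * \<gamma> + p * \<gamma>\<^sup>2"
      unfolding q'_def r'_def by (simp add: algebra_simps power2_eq_square)
    have "(k * \<alpha> - \<gamma>) * \<beta> - (k * \<beta> - \<delta>) * \<alpha> = 1" using u(1) by (simp add: algebra_simps)
    thus ?thesis using u(2,3) unfolding eq[symmetric] by blast
  qed
qed

text \<open>
  For determinant 1 the reduction bound forces the first coefficient to be 1, and completing the
  square does the rest.
\<close>

lemma binary_form_det_one:
  fixes p q r x y :: int
  assumes "p > 0" "p * r - q\<^sup>2 = 1"
  shows "\<exists>u v. p * x\<^sup>2 + 2 * q * x * y + r * y\<^sup>2 = u\<^sup>2 + v\<^sup>2"
proof -
  obtain \<alpha> \<beta> \<gamma> \<delta> where u: "\<alpha> * \<delta> - \<beta> * \<gamma> = 1"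
      "p * \<alpha>\<^sup>2 + 2 * q * \<alpha> * \<gamma> + r * \<gamma>\<^sup>2 > 0"
      "3 * (p * \<alpha>\<^sup>2 + 2 * q * \<alpha> * \<gamma> + r * \<gamma>\<^sup>2)\<^sup>2 \<le> 4 * 1"
    using binary_form_reduction[OF assms] by auto
  define p' where "p' = p * \<alpha>\<^sup>2 + 2 * q * \<alpha> * \<gamma> + r * \<gamma>\<^sup>2"
  define q' where "q' = p * \<alpha> * \<beta> + q * (\<alpha> * \<delta> + \<beta> * \<gamma>) + r * \<gamma> * \<delta>"
  define r' where "r' = p * \<beta>\<^sup>2 + 2 * q * \<beta> * \<delta> + r * \<delta>\<^sup>2"
  have p': "p' = 1"
  proof (rule ccontr)
    assume "p' \<noteq> 1"
    hence "2 \<le> p'" using u(2) unfolding p'_def by linarith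
    hence "2\<^sup>2 \<le> p'\<^sup>2" by (intro power_mono) auto
    thus False using u(3) unfolding p'_def by simp
  qed
  have "p' * r' - q'\<^sup>2 = (p * r - q\<^sup>2) * (\<alpha> * \<delta> - \<beta> * \<gamma>)\<^sup>2"
    unfolding p'_def q'_def r'_def by (simp add: algebra_simps power2_eq_square)
  hence r': "r' = 1 + q'\<^sup>2" using assms(2) u(1) p' by simp
  define X where "X = \<delta> * x - \<beta> * y"
  define Y where "Y = \<alpha> * y - \<gamma> * x"
  have "\<alpha> * X + \<beta> * Y = x * (\<alpha> * \<delta> - \<beta> * \<gamma>)" "\<gamma> * X + \<delta> * Y = y * (\<alpha> * \<delta> - \<beta> * \<gamma>)"
    unfolding X_def Y_def by (simp_all add: algebra_simps)
  hence xy: "x = \<alpha> * X + \<beta> * Y" "y = \<gamma> * X + \<delta> * Y" using u(1) by simp_all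
  have "p * x\<^sup>2 + 2 * q * x * y + r * y\<^sup>2 = p' * X\<^sup>2 + 2 * q' * X * Y + r' * Y\<^sup>2"
    unfolding xy p'_def q'_def r'_def by (simp add: algebra_simps power2_eq_square)
  also have "\<dots> = (X + q' * Y)\<^sup>2 + Y\<^sup>2"
    unfolding p' r' by (simp add: algebra_simps power2_eq_square)
  finally show ?thesis by blast
qed

text \<open>
  The coefficients \<open>r, s, t\<close> are off-diagonal entries of the symmetric matrix, so the cross terms are
  even; the determinant below is that of this matrix.
\<close>

definition ternary_form :: "int \<Rightarrow> int \<Rightarrow> int \<Rightarrow> int \<Rightarrow> int \<Rightarrow> int \<Rightarrow> int \<Rightarrow> int \<Rightarrow> int \<Rightarrow> int" where
  "ternary_form a b c r s t x y z =
     a * x\<^sup>2 + b * y\<^sup>2 + c * z\<^sup>2 + 2 * r * y * z + 2 * s * x * z + 2 * t * x * y"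

text \<open>
  Gauss' reduction, by induction on the leading coefficient \<open>a\<close>. Here \<open>a\<close> times the form equals
  \<open>(a x + t y + s z)\<^sup>2\<close> plus a binary form of determinant \<open>a\<close> in \<open>y\<close> and \<open>z\<close>. After reducing the binary form
  and translating \<open>x\<close>, the second diagonal coefficient is smaller than \<open>a\<close> unless \<open>27 a\<^sup>3 \<le> 64\<close>, that is,
  unless \<open>a = 1\<close>; so the first two variables can be exchanged. If \<open>a = 1\<close>, the form is a square plus a
  binary form of determinant 1. Since the conclusion speaks of all values of the form, it is invariant
  under these substitutions.
\<close>

lemma ternary_form_det_one:
  fixes a b c r s t x y z :: int
  assumes "a > 0" "a * b - t\<^sup>2 > 0"
    and "a * b * c + 2 * r * s * t - a * r\<^sup>2 - b * s\<^sup>2 - c * t\<^sup>2 = 1"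
  shows "\<exists>u v w. ternary_form a b c r s t x y z = u\<^sup>2 + v\<^sup>2 + w\<^sup>2"
  using assms
proof (induction "nat a" arbitrary: a b c r s t x y z rule: less_induct)
  case less
  define p where "p = a * b - t\<^sup>2"
  define q where "q = a * r - s * t"
  define h where "h = a * c - s\<^sup>2"
  have "p * h - q\<^sup>2 = a * (a * b * c + 2 * r * s * t - a * r\<^sup>2 - b * s\<^sup>2 - c * t\<^sup>2)"
    unfolding p_def q_def h_def by (simp add: algebra_simps power2_eq_square)
  hence det: "p * h - q\<^sup>2 = a" using less.prems(3) by simp
  have ppos: "p > 0" using less.prems(2) unfolding p_def .
  show ?case
  proof (cases "a = 1")
    case True
    obtain u v where "p * y\<^sup>2 + 2 * q * y * z + h * z\<^sup>2 = u\<^sup>2 + v\<^sup>2"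
      using binary_form_det_one[OF ppos] det True by blast
    hence "ternary_form a b c r s t x y z = (x + t * y + s * z)\<^sup>2 + u\<^sup>2 + v\<^sup>2"
      unfolding ternary_form_def p_def q_def h_def True by (simp add: algebra_simps power2_eq_square)
    thus ?thesis by blast
  next
    case False
    obtain \<alpha> \<beta> \<gamma> \<delta> where u: "\<alpha> * \<delta> - \<beta> * \<gamma> = 1"
        "p * \<alpha>\<^sup>2 + 2 * q * \<alpha> * \<gamma> + h * \<gamma>\<^sup>2 > 0"
        "3 * (p * \<alpha>\<^sup>2 + 2 * q * \<alpha> * \<gamma> + h * \<gamma>\<^sup>2)\<^sup>2 \<le> 4 * a"
      using binary_form_reduction[OF ppos det less.prems(1)] by auto
    define p' where "p' = p * \<alpha>\<^sup>2 + 2 * q * \<alpha> * \<gamma> + h * \<gamma>\<^sup>2"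
    define b1 where "b1 = b * \<alpha>\<^sup>2 + 2 * r * \<alpha> * \<gamma> + c * \<gamma>\<^sup>2"
    define c1 where "c1 = b * \<beta>\<^sup>2 + 2 * r * \<beta> * \<delta> + c * \<delta>\<^sup>2"
    define r1 where "r1 = b * \<alpha> * \<beta> + r * (\<alpha> * \<delta> + \<beta> * \<gamma>) + c * \<gamma> * \<delta>"
    define t1 where "t1 = t * \<alpha> + s * \<gamma>"
    define s1 where "s1 = t * \<beta> + s * \<delta>"
    have p'1: "a * b1 - t1\<^sup>2 = p'"
      unfolding b1_def t1_def p'_def p_def q_def h_def by (simp add: algebra_simps power2_eq_square)
    have "a * b1 * c1 + 2 * r1 * s1 * t1 - a * r1\<^sup>2 - b1 * s1\<^sup>2 - c1 * t1\<^sup>2 =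
          (a * b * c + 2 * r * s * t - a * r\<^sup>2 - b * s\<^sup>2 - c * t\<^sup>2) * (\<alpha> * \<delta> - \<beta> * \<gamma>)\<^sup>2"
      unfolding b1_def c1_def r1_def s1_def t1_def by (simp add: algebra_simps power2_eq_square)
    hence det1: "a * b1 * c1 + 2 * r1 * s1 * t1 - a * r1\<^sup>2 - b1 * s1\<^sup>2 - c1 * t1\<^sup>2 = 1"
      using u(1) less.prems(3) by simp
    obtain k where k: "2 * \<bar>t1 + k * a\<bar> \<le> a"
      using exists_centered_residue[OF less.prems(1)] by blast
    define t2 where "t2 = t1 + k * a"
    define b2 where "b2 = b1 + 2 * k * t1 + k\<^sup>2 * a"
    define r2 where "r2 = r1 + k * s1"
    have p'2: "a * b2 - t2\<^sup>2 = p'"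
      using p'1 unfolding b2_def t2_def by (simp add: algebra_simps power2_eq_square)
    have det2: "b2 * a * c1 + 2 * s1 * r2 * t2 - b2 * s1\<^sup>2 - a * r2\<^sup>2 - c1 * t2\<^sup>2 = 1"
      using det1 unfolding b2_def t2_def r2_def by (simp add: algebra_simps power2_eq_square)
    have "\<bar>2 * t2\<bar>\<^sup>2 \<le> a\<^sup>2" using k less.prems(1) unfolding t2_def abs_mult by (intro power_mono) auto
    hence t22: "4 * t2\<^sup>2 \<le> a\<^sup>2" by (simp add: power_mult_distrib)
    have p'pos: "p' > 0" using u(2) unfolding p'_def .
    have "a * b2 > 0" using p'2 p'pos by (smt (verit) zero_le_power2)
    hence b2pos: "b2 > 0" using less.prems(1) by (simp add: zero_less_mult_iff)
    have "b2 < a"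
    proof (rule ccontr)
      assume "\<not> b2 < a"
      hence "a\<^sup>2 \<le> a * b2" using less.prems(1) by (simp add: power2_eq_square)
      hence "3 * a\<^sup>2 \<le> 4 * p'" using p'2 t22 by linarith
      hence "(3 * a\<^sup>2)\<^sup>2 \<le> (4 * p')\<^sup>2" by (intro power_mono) auto
      hence "27 * (a\<^sup>2)\<^sup>2 \<le> 64 * a" using u(3) unfolding p'_def[symmetric]
        by (simp add: power_mult_distrib)
      hence "a * (27 * a ^ 3) \<le> a * 64" by (simp add: power2_eq_square power3_eq_cube algebra_simps)
      hence a3: "27 * a ^ 3 \<le> 64" using less.prems(1) by simp
      have "2 \<le> a" using False less.prems(1) by linarith
      hence "2 ^ 3 \<le> a ^ 3" by (intro power_mono) auto
      thus False using a3 by simp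
    qed
    define Y where "Y = \<delta> * y - \<beta> * z"
    define Z where "Z = \<alpha> * z - \<gamma> * y"
    have "\<alpha> * Y + \<beta> * Z = y * (\<alpha> * \<delta> - \<beta> * \<gamma>)" "\<gamma> * Y + \<delta> * Z = z * (\<alpha> * \<delta> - \<beta> * \<gamma>)"
      unfolding Y_def Z_def by (simp_all add: algebra_simps)
    hence yz: "y = \<alpha> * Y + \<beta> * Z" "z = \<gamma> * Y + \<delta> * Z" using u(1) by simp_all
    have "ternary_form a b c r s t x y z = ternary_form a b1 c1 r1 s1 t1 x Y Z"
      unfolding yz ternary_form_def b1_def c1_def r1_def s1_def t1_def
      by (simp add: algebra_simps power2_eq_square)
    also have "\<dots> = ternary_form b2 a c1 s1 r2 t2 Y (x - k * Y) Z"
      unfolding ternary_form_def b2_def r2_def t2_def by (simp add: algebra_simps power2_eq_square)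
    finally have eq: "ternary_form a b c r s t x y z = ternary_form b2 a c1 s1 r2 t2 Y (x - k * Y) Z" .
    have "b2 * a - t2\<^sup>2 > 0" using p'2 p'pos by (simp add: mult.commute)
    from less.hyps[OF _ b2pos this det2] \<open>b2 < a\<close> b2pos show ?thesis unfolding eq by simp
  qed
qed

section \<open>Sums of three squares from mutual quadratic residues\<close>

text \<open>
  The form with matrix \<open>((B, x), (x, K))\<close>, where \<open>x\<^sup>2 + m = B K\<close>, has determinant \<open>m\<close>. Since \<open>-B\<close> is an
  invertible square modulo \<open>m\<close>, the form properly represents a number \<open>M\<close> with \<open>M = -1\<close> modulo \<open>m\<close>, say
  \<open>M = m b - 1\<close>. Proper representation makes \<open>-m\<close> a square modulo \<open>M\<close>, and as \<open>b\<close> is the inverse of \<open>m\<close>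
  modulo \<open>M\<close>, also \<open>-b\<close> is a square \<open>t\<^sup>2\<close> modulo \<open>M\<close>. With \<open>a M - t\<^sup>2 = b\<close>, the matrix
  \<open>((a, t, 1), (t, M, 0), (1, 0, m))\<close> has determinant \<open>m b - M = 1\<close>, and its form takes the value \<open>m\<close> at
  \<open>(0, 0, 1)\<close>.
\<close>

lemma three_squares_of_mutual_residues:
  fixes m B :: int
  assumes m: "m > 0" and B: "B > 0" and cop: "coprime B m"
    and "QuadRes B (- m)" "QuadRes m (- B)"
  shows "\<exists>u v w. m = u\<^sup>2 + v\<^sup>2 + w\<^sup>2"
proof -
  obtain x where "[x\<^sup>2 = - m] (mod B)" using assms(4) unfolding QuadRes_def by blast
  hence "B dvd x\<^sup>2 + m" by (simp add: cong_iff_dvd_diff)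
  then obtain K where K: "x\<^sup>2 + m = B * K" by blast
  obtain y where y: "[y\<^sup>2 = - B] (mod m)" using assms(5) unfolding QuadRes_def by blast
  have "coprime (y\<^sup>2) m" using cong_imp_coprime[OF cong_sym[OF y]] cop by simp
  hence "coprime y m" by simp
  then obtain X where X: "[y * X = 1] (mod m)" using cong_solve_coprime_int by blast
  have "[(y * X)\<^sup>2 = 1\<^sup>2] (mod m)" using X by (rule cong_pow)
  moreover have "[(y * X)\<^sup>2 = - B * X\<^sup>2] (mod m)"
    unfolding power_mult_distrib using y by (intro cong_mult cong_refl)
  ultimately have "[- B * X\<^sup>2 = 1] (mod m)" by (metis cong_sym cong_trans one_power2)
  hence BX: "m dvd B * X\<^sup>2 + 1"
    by (metis add.commute cong_iff_dvd_diff diff_minus_eq_add dvd_minus_iff minus_diff_eq mult_minus_left)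
  have "coprime X m" using X by (metis cong_imp_coprime cong_sym coprime_1_left coprime_mult_left_iff)
  then obtain V U where UV: "V * X + U * m = 1" using bezout_int[of X m] by (auto simp: coprime_iff_gcd_eq_1)
  \<comment> \<open>\<open>M\<close> is the value at \<open>(X, m)\<close>; the second column \<open>(-U, V)\<close> completes this vector to a unimodular
  matrix, \<open>L\<close> is the value there, and \<open>z\<close> is the new off-diagonal entry.\<close>
  define M where "M = B * X\<^sup>2 + 2 * x * X * m + K * m\<^sup>2"
  define z where "z = - B * X * U + x * (X * V - m * U) + K * m * V"
  define L where "L = B * U\<^sup>2 - 2 * x * U * V + K * V\<^sup>2"
  have "M * L - z\<^sup>2 = (B * K - x\<^sup>2) * (V * X + U * m)\<^sup>2"
    unfolding M_def L_def z_def by (simp add: algebra_simps power2_eq_square)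
  hence zM: "z\<^sup>2 + m = M * L" using K UV by simp
  have "B * M = (B * X + x * m)\<^sup>2 + (B * K - x\<^sup>2) * m\<^sup>2"
    unfolding M_def by (simp add: algebra_simps power2_eq_square)
  also have "B * K - x\<^sup>2 = m" using K by simp
  finally have "B * M > 0" using m by (simp add: add_nonneg_pos)
  hence M: "M > 0" using B by (simp add: zero_less_mult_iff)
  have "m dvd M + 1"
  proof -
    have eq: "M + 1 = (B * X\<^sup>2 + 1) + m * (2 * x * X + K * m)"
      unfolding M_def by (simp add: algebra_simps power2_eq_square)
    show ?thesis unfolding eq by (intro dvd_add[OF BX] dvd_triv_left)
  qed
  then obtain b where b: "M + 1 = m * b" by blast
  hence "m * b > 0" using M by simp
  hence bpos: "b > 0" using m by (simp add: zero_less_mult_iff)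
  \<comment> \<open>As \<open>m b = 1\<close> and \<open>z\<^sup>2 = -m\<close> modulo \<open>M\<close>, the square of \<open>z b\<close> is \<open>-b\<close> modulo \<open>M\<close>.\<close>
  define t where "t = z * b"
  have "t\<^sup>2 + b = b\<^sup>2 * (z\<^sup>2 + m) - b * (m * b - 1)"
    unfolding t_def by (simp add: algebra_simps power2_eq_square)
  also have "m * b - 1 = M" using b by simp
  also have "b\<^sup>2 * (z\<^sup>2 + m) - b * M = M * (b\<^sup>2 * L - b)"
    unfolding zM by (simp add: algebra_simps)
  finally have t: "t\<^sup>2 + b = M * (b\<^sup>2 * L - b)" .
  define a where "a = b\<^sup>2 * L - b"
  have aM: "a * M - t\<^sup>2 = b" using t unfolding a_def by (simp add: algebra_simps)
  have "M * a > 0" using t bpos unfolding a_def by (metis add_nonneg_pos zero_le_power2)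
  hence a: "a > 0" using M by (simp add: zero_less_mult_iff)
  have "a * M * m + 2 * 0 * 1 * t - a * 0\<^sup>2 - M * 1\<^sup>2 - m * t\<^sup>2 = m * (a * M - t\<^sup>2) - M"
    by (simp add: algebra_simps)
  also have "\<dots> = 1" unfolding aM using b by simp
  finally have det: "a * M * m + 2 * 0 * 1 * t - a * 0\<^sup>2 - M * 1\<^sup>2 - m * t\<^sup>2 = 1" .
  have "a * M - t\<^sup>2 > 0" using aM bpos by simp
  from ternary_form_det_one[OF a this det, of 0 0 1]
  show ?thesis by (simp add: ternary_form_def)
qed


section \<open>Real characters\<close>

definition real_character :: "nat \<Rightarrow> (nat \<Rightarrow> int) \<Rightarrow> bool" where
  "real_character q f \<longleftrightarrow>
     (\<forall>a b. f (a * b) = f a * f b) \<and> (\<forall>a. f (a mod q) = f a) \<and>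
     (\<forall>a. coprime a q \<longrightarrow> f a \<in> {1, -1}) \<and> (\<forall>a. \<not> coprime a q \<longrightarrow> f a = 0)"

lemma real_characterD:
  assumes "real_character q f"
  shows "f (a * b) = f a * f b" "f (a mod q) = f a" "f a \<in> {-1, 0, 1}"
    "coprime a q \<Longrightarrow> f a \<in> {1, -1}" "coprime a q \<Longrightarrow> f a * f a = 1" "\<not> coprime a q \<Longrightarrow> f a = 0"
    "\<bar>f a\<bar> \<le> 1" "f 1 = 1"
proof -
  show m: "f (a * b) = f a * f b" and "f (a mod q) = f a" and c: "coprime a q \<Longrightarrow> f a \<in> {1, -1}"
    and nc: "\<not> coprime a q \<Longrightarrow> f a = 0" for a b
    using assms unfolding real_character_def by blast+
  from c[of a] nc[of a] show "f a \<in> {-1, 0, 1}" "\<bar>f a\<bar> \<le> 1" "coprime a q \<Longrightarrow> f a * f a = 1"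
    by (cases "coprime a q"; force)+
  show "f 1 = 1" using m[of 1 1] c[of 1] by auto
qed

lemma real_character_power:
  assumes "real_character q f"
  shows "f (a ^ k) = f a ^ k"
  by (induction k) (simp_all add: real_characterD(1,8)[OF assms] real_characterD(8)[OF assms, simplified])

lemma real_character_principal: 
  assumes "q > 0"
  shows "real_character q (\<lambda>n. if coprime n q then 1 else 0)"
  unfolding real_character_def using assms by (auto simp: coprime_mod_left_iff)

lemma real_character_mult:
  assumes "real_character q f" "real_character q g"
  shows "real_character q (\<lambda>n. f n * g n)"
  unfolding real_character_def
  using real_characterD(1,2,6)[OF assms(1)] real_characterD(1,2)[OF assms(2)]
        real_characterD(4)[OF assms(1)] real_characterD(4)[OF assms(2)]
  by (auto simp: algebra_simps) (metis insertE singletonD mult_minus1_right mult.right_neutral minus_minus)+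

lemma real_character_prod:
  assumes "q > 0" "finite S" "\<And>i. i \<in> S \<Longrightarrow> real_character q (f i)"
  shows "real_character q (\<lambda>n. (if coprime n q then 1 else 0) * (\<Prod>i\<in>S. f i n))"
  using assms(2,3)
proof (induction S rule: finite_induct)
  case empty
  thus ?case using real_character_principal[OF assms(1)] by simp
next
  case (insert i S)
  have "real_character q (\<lambda>n. f i n * ((if coprime n q then 1 else 0) * (\<Prod>i\<in>S. f i n)))"
    by (rule real_character_mult) (use insert in auto)
  moreover have "f i n * ((if coprime n q then 1 else 0) * (\<Prod>i\<in>S. f i n)) =
      (if coprime n q then 1 else 0) * (\<Prod>i\<in>insert i S. f i n)" for n
    using insert by simp
  ultimately show ?case by simp
qed

text \<open>
  Multiplication by \<open>u\<close> permutes the residues and changes the sign of the sum.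
\<close>

lemma real_character_sum_period:
  assumes f: "real_character q f" and q: "q > 0" and u: "coprime u q" "f u = -1"
  shows "(\<Sum>n<q. f n) = 0"
proof -
  have inj: "inj_on (\<lambda>n. u * n mod q) {..<q}"
  proof (rule inj_onI)
    fix a b assume ab: "a \<in> {..<q}" "b \<in> {..<q}" "u * a mod q = u * b mod q"
    hence "[u * a = u * b] (mod q)" by (simp add: cong_def)
    hence "[a = b] (mod q)" using u(1) cong_mult_lcancel_nat by blast
    thus "a = b" using ab by (simp add: cong_def)
  qed
  have "(\<lambda>n. u * n mod q) ` {..<q} = {..<q}"
    by (rule endo_inj_surj[OF _ _ inj]) (use q in auto)
  hence bij: "bij_betw (\<lambda>n. u * n mod q) {..<q} {..<q}" using inj by (simp add: bij_betw_def)
  have "(\<Sum>n<q. f n) = (\<Sum>n<q. f (u * n mod q))"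
    using sum.reindex_bij_betw[OF bij, of f] by simp
  also have "\<dots> = (\<Sum>n<q. - f n)"
    by (intro sum.cong) (simp_all add: real_characterD[OF f] u(2))
  finally show ?thesis by (simp add: sum_negf)
qed

text \<open>
  Full periods cancel, so an initial segment is only as large as its last incomplete period.
\<close>

lemma real_character_block_sum:
  assumes f: "real_character q f" and q: "q > 0" and u: "coprime u q" "f u = -1"
  shows "\<bar>\<Sum>n=a..<b. f n\<bar> \<le> 2 * int q"
proof -
  have init: "\<bar>\<Sum>n<N. f n\<bar> \<le> int q" for N
  proof (induction N rule: less_induct)
    case (less N)
    show ?case
    proof (cases "N \<le> q")
      case True
      have "\<bar>\<Sum>n<N. f n\<bar> \<le> (\<Sum>n<N. \<bar>f n\<bar>)" by (rule sum_abs)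
      also have "\<dots> \<le> (\<Sum>n<N. 1)" by (intro sum_mono real_characterD(7)[OF f])
      finally show ?thesis using True by simp
    next
      case False
      define M where "M = N - q"
      have N: "N = q + M" and "M < N" using False q unfolding M_def by auto
      have "(\<Sum>n<N. f n) = (\<Sum>n<q. f n) + (\<Sum>n<M. f (q + n))"
        unfolding N lessThan_atLeast0 
        by (subst sum.atLeastLessThan_concat[of 0 q "q + M", symmetric])
           (simp_all add: sum.shift_bounds_nat_ivl[of f 0 q M, simplified] add.commute)
      also have "(\<Sum>n<M. f (q + n)) = (\<Sum>n<M. f n)"
        by (intro sum.cong refl) (metis mod_add_self1 real_characterD(2)[OF f])
      finally have "(\<Sum>n<N. f n) = (\<Sum>n<M. f n)" using real_character_sum_period[OF assms] by simp
      thus ?thesis using less.IH[OF \<open>M < N\<close>] by simp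
    qed
  qed
  show ?thesis
  proof (cases "a \<le> b")
    case True
    have "(\<Sum>n<b. f n) = (\<Sum>n<a. f n) + (\<Sum>n=a..<b. f n)"
      unfolding lessThan_atLeast0 using True by (simp add: sum.atLeastLessThan_concat)
    thus ?thesis using init[of a] init[of b] by linarith
  qed simp
qed

section \<open>Weighted sums of Dirichlet convolutions\<close>

lemma abel_summation_bound:
  fixes h w :: "nat \<Rightarrow> real"
  assumes "\<And>k. \<bar>\<Sum>i=a..<k. h i\<bar> \<le> C"
    and "\<And>i. a \<le> i \<Longrightarrow> w (Suc i) \<le> w i" "\<And>i. w i \<ge> 0"
  shows "\<bar>\<Sum>i=a..<b. h i * w i\<bar> \<le> C * w a"
proof (cases "a \<le> b")
  case True
  define P where "P k = (\<Sum>i=a..<k. h i)" for k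
  have id: "(\<Sum>i=a..<b. h i * w i) = P b * w b + (\<Sum>i=a..<b. P (Suc i) * (w i - w (Suc i)))"
    using True
  proof (induction b rule: dec_induct)
    case base
    thus ?case by (simp add: P_def)
  next
    case (step n)
    have "P (Suc n) = P n + h n" using step(1) by (simp add: P_def)
    thus ?case using step by (simp add: algebra_simps)
  qed
  have tele: "(\<Sum>i=a..<b. w i - w (Suc i)) = w a - w b"
    using True by (induction b rule: dec_induct) auto
  have Pb: "\<bar>P k\<bar> \<le> C" for k using assms(1) unfolding P_def .
  have "\<bar>\<Sum>i=a..<b. P (Suc i) * (w i - w (Suc i))\<bar> \<le> (\<Sum>i=a..<b. \<bar>P (Suc i) * (w i - w (Suc i))\<bar>)"
    by (rule sum_abs)
  also have "\<dots> \<le> (\<Sum>i=a..<b. C * (w i - w (Suc i)))"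
    using assms(2) Pb by (intro sum_mono) (auto simp: abs_mult intro!: mult_right_mono)
  also have "\<dots> = C * (w a - w b)" by (simp add: sum_distrib_left[symmetric] tele)
  finally have "\<bar>\<Sum>i=a..<b. P (Suc i) * (w i - w (Suc i))\<bar> \<le> C * (w a - w b)" .
  moreover have "\<bar>P b * w b\<bar> \<le> C * w b"
    using Pb assms(3)[of b] by (auto simp: abs_mult intro!: mult_right_mono)
  ultimately show ?thesis unfolding id by (simp add: algebra_simps)
next
  case False
  thus ?thesis using assms(1)[of a] assms(3)[of a] by simp
qed

lemma sum_inverse_sqrt_le: "(\<Sum>d=1..Y. 1 / sqrt (real d)) \<le> 2 * sqrt (real Y)"
proof (induction Y)
  case (Suc Y)
  have "1 / sqrt (real (Suc Y)) \<le> 2 * (sqrt (real (Suc Y)) - sqrt (real Y))"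
  proof -
    define s t where "s = sqrt (real (Suc Y))" and "t = sqrt (real Y)"
    have st: "0 < s" "0 \<le> t" "t \<le> s" "s\<^sup>2 - t\<^sup>2 = 1" unfolding s_def t_def by auto
    have "1 = (s - t) * (s + t)" using st(4) by (simp add: algebra_simps power2_eq_square)
    also have "\<dots> \<le> (s - t) * (2 * s)" using st by (intro mult_left_mono) auto
    finally have "1 / s \<le> 2 * (s - t)"
      using st(1) by (subst pos_divide_le_eq) (simp_all add: algebra_simps)
    thus ?thesis unfolding s_def t_def .
  qed
  thus ?case using Suc by simp
qed simp

text \<open>
  The contribution of the region \<open>d \<le> Y < e\<close> to the hyperbola method. The cut-off \<open>N d\<close> is arbitrary, because
  summation by parts bounds all inner sums by \<open>C / sqrt (Y + 1)\<close> alike.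
\<close>

lemma hyperbola_tail_bound:
  fixes g h :: "nat \<Rightarrow> real"
  assumes g: "\<And>n. \<bar>g n\<bar> \<le> 1" and h: "\<And>a b. \<bar>\<Sum>i=a..<b. h i\<bar> \<le> C"
  shows "\<bar>\<Sum>d=1..Y. g d / sqrt (real d) * (\<Sum>e=Suc Y..<N d. h e / sqrt (real e))\<bar> \<le> 2 * C"
proof -
  have C: "C \<ge> 0" using h[of 0 0] by simp
  have inner: "\<bar>\<Sum>e=Suc Y..<N d. h e / sqrt (real e)\<bar> \<le> C * (1 / sqrt (real (Suc Y)))" for d
    using abel_summation_bound[where a = "Suc Y" and h = h and C = C and w = "\<lambda>n. 1 / sqrt (real n)" and b = "N d"] h
    by (auto simp: frac_le)
  have "\<bar>\<Sum>d=1..Y. g d / sqrt (real d) * (\<Sum>e=Suc Y..<N d. h e / sqrt (real e))\<bar>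
      \<le> (\<Sum>d=1..Y. \<bar>g d / sqrt (real d) * (\<Sum>e=Suc Y..<N d. h e / sqrt (real e))\<bar>)"
    by (rule sum_abs)
  also have "\<dots> \<le> (\<Sum>d=1..Y. (1 / sqrt (real d)) * (C * (1 / sqrt (real (Suc Y)))))"
    unfolding abs_mult using g inner by (intro sum_mono mult_mono) (auto simp: divide_right_mono)
  also have "\<dots> = (\<Sum>d=1..Y. 1 / sqrt (real d)) * (C * (1 / sqrt (real (Suc Y))))"
    by (rule sum_distrib_right[symmetric])
  also have "\<dots> \<le> (2 * sqrt (real Y)) * (C * (1 / sqrt (real (Suc Y))))"
    using sum_inverse_sqrt_le C by (intro mult_right_mono) auto
  also have "\<dots> = 2 * C * (sqrt (real Y) / sqrt (real (Suc Y)))" by simp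
  also have "\<dots> \<le> 2 * C * 1" using C by (intro mult_left_mono) (auto simp: divide_le_eq)
  finally show ?thesis by simp
qed

text \<open>
  Dirichlet's hyperbola method. The pairs \<open>(d, e)\<close> with \<open>d e \<le> Y\<^sup>2\<close> split into the square \<open>d, e \<le> Y\<close> and two
  regions in which exactly one variable exceeds \<open>Y\<close>. On the square the sum factors, and each factor is
  at most \<open>C\<close>. In the other regions summation by parts bounds the sum over the large variable by
  \<open>C / sqrt Y\<close>, and the sum over the small variable contributes at most \<open>2 sqrt Y\<close>.
\<close>

lemma dirichlet_convolution_bound:
  fixes g h :: "nat \<Rightarrow> real"
  assumes g1: "\<And>n. \<bar>g n\<bar> \<le> 1" and h1: "\<And>n. \<bar>h n\<bar> \<le> 1"
    and g: "\<And>a b. \<bar>\<Sum>i=a..<b. g i\<bar> \<le> C" and h: "\<And>a b. \<bar>\<Sum>i=a..<b. h i\<bar> \<le> C"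
  shows "\<bar>\<Sum>n=1..Y\<^sup>2. (\<Sum>d | d dvd n. g d * h (n div d)) / sqrt (real n)\<bar> \<le> C\<^sup>2 + 4 * C"
proof -
  define F where "F = (\<lambda>(d, e). (g d / sqrt (real d)) * (h e / sqrt (real e)))"
  define P where "P = {(d, e). 1 \<le> d \<and> 1 \<le> e \<and> d * e \<le> Y\<^sup>2}"
  define P1 where "P1 = {1..Y} \<times> {1..Y}"
  define P2 where "P2 = Sigma {1..Y} (\<lambda>d. {Suc Y..<Suc (Y\<^sup>2 div d)})"
  define P3 where "P3 = (\<lambda>(e, d). (d, e)) ` P2"
  have C: "C \<ge> 0" using h[of 0 0] by simp
  have "(\<Sum>n=1..Y\<^sup>2. (\<Sum>d | d dvd n. g d * h (n div d)) / sqrt (real n)) =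
        (\<Sum>n=1..Y\<^sup>2. \<Sum>d | d dvd n. F (d, n div d))"
  proof (intro sum.cong refl)
    fix n assume n: "n \<in> {1..Y\<^sup>2}"
    have "(g d * h (n div d)) / sqrt (real n) = F (d, n div d)" if "d dvd n" for d
    proof -
      from that obtain e where e: "n = d * e" by blast
      thus ?thesis using n by (cases "d = 0") (auto simp: F_def real_sqrt_mult)
    qed
    thus "(\<Sum>d | d dvd n. g d * h (n div d)) / sqrt (real n) = (\<Sum>d | d dvd n. F (d, n div d))"
      by (simp add: sum_divide_distrib)
  qed
  also have "\<dots> = (\<Sum>(n, d)\<in>Sigma {1..Y\<^sup>2} (\<lambda>n. {d. d dvd n}). F (d, n div d))"
    by (rule sum.Sigma) auto
  also have "\<dots> = sum F P"
    by (rule sum.reindex_bij_witness[of _ "\<lambda>(d, e). (d * e, d)" "\<lambda>(n, d). (d, n div d)"])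
       (auto simp: P_def dvd_div_eq_0_iff Suc_le_eq intro!: Nat.gr0I)
  also have "P = P1 \<union> (P2 \<union> P3)"
  proof (intro equalityI subsetI)
    fix x assume "x \<in> P"
    then obtain d e where x: "x = (d, e)" and de: "1 \<le> d" "1 \<le> e" "d * e \<le> Y\<^sup>2"
      unfolding P_def by blast
    have "\<not> (d > Y \<and> e > Y)"
    proof
      assume "d > Y \<and> e > Y"
      hence "Y * Y < d * e" by (intro mult_strict_mono) auto
      thus False using de by (simp add: power2_eq_square)
    qed
    moreover have "e \<le> Y\<^sup>2 div d" "d \<le> Y\<^sup>2 div e"
      using de by (simp_all add: less_eq_div_iff_mult_less_eq mult.commute)
    ultimately show "x \<in> P1 \<union> (P2 \<union> P3)"
      using de unfolding x P1_def P2_def P3_def by (force simp: image_iff)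
  next
    fix x assume "x \<in> P1 \<union> (P2 \<union> P3)"
    moreover have "d * e \<le> Y\<^sup>2" if "d \<le> Y" "e \<le> Y" for d e
      using mult_le_mono[OF that] by (simp add: power2_eq_square)
    moreover have "d * e \<le> Y\<^sup>2" "e * d \<le> Y\<^sup>2" if "1 \<le> d" "e < Suc (Y\<^sup>2 div d)" for d e
      using that by (simp_all add: less_Suc_eq_le less_eq_div_iff_mult_less_eq mult.commute)
    ultimately show "x \<in> P" unfolding P1_def P2_def P3_def P_def by auto
  qed
  also have "sum F \<dots> = sum F P1 + (sum F P2 + sum F P3)"
  proof -
    have "finite P1" "finite P2" "finite P3" unfolding P1_def P2_def P3_def by auto
    moreover have "P2 \<inter> P3 = {}" "P1 \<inter> (P2 \<union> P3) = {}" unfolding P1_def P2_def P3_def by auto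
    ultimately show ?thesis by (simp add: sum.union_disjoint)
  qed
  finally have eq: "(\<Sum>n=1..Y\<^sup>2. (\<Sum>d | d dvd n. g d * h (n div d)) / sqrt (real n)) =
        sum F P1 + (sum F P2 + sum F P3)" .
  have one: "\<bar>\<Sum>d=1..Y. f d / sqrt (real d)\<bar> \<le> C" if "\<And>a b. \<bar>\<Sum>i=a..<b. f i\<bar> \<le> C" for f
    using abel_summation_bound[where a = 1 and h = f and C = C and w = "\<lambda>n. 1 / sqrt (real n)" and b = "Suc Y"] that
    by (auto simp: frac_le atLeastLessThanSuc_atLeastAtMost)
  have "sum F P1 = (\<Sum>d=1..Y. g d / sqrt (real d)) * (\<Sum>e=1..Y. h e / sqrt (real e))"
    unfolding P1_def F_def by (simp add: sum.cartesian_product[symmetric] sum_product)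
  hence "\<bar>sum F P1\<bar> \<le> C\<^sup>2"
    using mult_mono[OF one[OF g] one[OF h]] C by (simp add: abs_mult power2_eq_square)
  moreover have "sum F P2 =
     (\<Sum>d=1..Y. g d / sqrt (real d) * (\<Sum>e=Suc Y..<Suc (Y\<^sup>2 div d). h e / sqrt (real e)))"
    unfolding P2_def F_def sum_distrib_left by (rule sum.Sigma[symmetric]) simp_all
  hence "\<bar>sum F P2\<bar> \<le> 2 * C" using hyperbola_tail_bound[OF g1 h] by (simp only:)
  moreover have "sum F P3 =
     (\<Sum>e=1..Y. h e / sqrt (real e) * (\<Sum>d=Suc Y..<Suc (Y\<^sup>2 div e). g d / sqrt (real d)))"
  proof -
    have "sum F P3 = (\<Sum>(e, d)\<in>P2. (h e / sqrt (real e)) * (g d / sqrt (real d)))"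
      unfolding P3_def F_def
      by (subst sum.reindex) (auto simp: inj_on_def case_prod_unfold mult.commute)
    also have "\<dots> = (\<Sum>e=1..Y. \<Sum>d=Suc Y..<Suc (Y\<^sup>2 div e).
        (h e / sqrt (real e)) * (g d / sqrt (real d)))"
      unfolding P2_def by (rule sum.Sigma[symmetric]) simp_all
    finally show ?thesis unfolding sum_distrib_left .
  qed
  hence "\<bar>sum F P3\<bar> \<le> 2 * C" using hyperbola_tail_bound[OF h1 g] by (simp only:)
  ultimately show ?thesis unfolding eq by linarith
qed

section \<open>Divisor sums of a real character\<close>

text \<open>
  The new divisors are those divisible by the full power of \<open>p\<close>. Iterating this replaces the multiplicativity
  of divisor sums, one prime at a time.
\<close>

lemma sum_divisors_prime_power_step:
  fixes p m :: nat and f :: "nat \<Rightarrow> int"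
  assumes p: "prime p" and m: "\<not> p dvd m" "m > 0"
  shows "(\<Sum>d | d dvd p ^ Suc k * m. f d) =
           (\<Sum>d | d dvd p ^ k * m. f d) + (\<Sum>d | d dvd m. f (p ^ Suc k * d))"
proof -
  have p0: "p > 0" using p prime_gt_0_nat by blast
  have fin: "finite {d. d dvd p ^ j * m}" for j using m(2) p0 by simp
  have split: "{d. d dvd p ^ Suc k * m} = {d. d dvd p ^ k * m} \<union> (\<lambda>d. p ^ Suc k * d) ` {d. d dvd m}"
  proof (intro equalityI subsetI)
    fix d assume "d \<in> {d. d dvd p ^ Suc k * m}"
    hence d: "d dvd p ^ Suc k * m" by simp
    show "d \<in> {d. d dvd p ^ k * m} \<union> (\<lambda>d. p ^ Suc k * d) ` {d. d dvd m}"
    proof (cases "p ^ Suc k dvd d")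
      case True
      then obtain d' where d': "d = p ^ Suc k * d'" by blast
      hence "d' dvd m" using d p0 by simp
      thus ?thesis using d' by auto
    next
      case False
      have "d \<noteq> 0" using d m(2) p0 by (intro notI) auto
      then obtain e where e: "d = p ^ multiplicity p d * e" "\<not> p dvd e"
        using multiplicity_decompose'[of d p] p not_prime_unit by blast
      have "coprime e (p ^ Suc k)" using e(2) p
        by (metis coprime_commute coprime_power_right_iff prime_imp_coprime)
      moreover have "e dvd p ^ Suc k * m" using d e(1) by (metis dvd_mult_right)
      ultimately have "e dvd m" by (metis coprime_dvd_mult_right_iff)
      moreover have "multiplicity p d \<le> k"
        using False by (metis multiplicity_dvd' not_less_eq_eq)
      ultimately have "d dvd p ^ k * m" by (subst e(1)) (auto intro!: mult_dvd_mono le_imp_power_dvd)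
      thus ?thesis by simp
    qed
  qed (auto simp: mult.assoc)
  have disj: "{d. d dvd p ^ k * m} \<inter> (\<lambda>d. p ^ Suc k * d) ` {d. d dvd m} = {}"
  proof -
    have False if "p ^ Suc k * d dvd p ^ k * m" for d
    proof -
      have "p ^ k * (p * d) dvd p ^ k * m" using that by (simp add: mult_ac)
      hence "p * d dvd m" using p0 by simp
      thus False using m(1) dvd_mult_left by blast
    qed
    thus ?thesis by blast
  qed
  have "(\<Sum>d \<in> (\<lambda>d. p ^ Suc k * d) ` {d. d dvd m}. f d) = (\<Sum>d | d dvd m. f (p ^ Suc k * d))"
    using p0 by (subst sum.reindex) (auto simp: inj_on_def)
  thus ?thesis unfolding split using fin[of k] fin[of 0] disj by (subst sum.union_disjoint) auto
qed

text \<open>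
  If \<open>\<omega>\<close> is the character of a quadratic field, this is the number of ideals of norm \<open>n\<close> in its ring of
  integers.
\<close>

definition twisted_divisor_count :: "(nat \<Rightarrow> int) \<Rightarrow> nat \<Rightarrow> int" where
  "twisted_divisor_count \<omega> n = (\<Sum>d | d dvd n. \<omega> d)"

lemma twisted_divisor_count_prime_power:
  assumes \<omega>: "real_character q \<omega>" and p: "prime p" and m: "\<not> p dvd m" "m > 0"
  shows "twisted_divisor_count \<omega> (p ^ k * m) = (\<Sum>j\<le>k. \<omega> p ^ j) * twisted_divisor_count \<omega> m"
proof (induction k)
  case (Suc k)
  have "(\<Sum>d | d dvd m. \<omega> (p ^ Suc k * d)) = \<omega> p ^ Suc k * twisted_divisor_count \<omega> m"
    unfolding twisted_divisor_count_def sum_distrib_left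
    by (intro sum.cong refl) (metis real_characterD(1)[OF \<omega>] real_character_power[OF \<omega>])
  thus ?case
    using Suc sum_divisors_prime_power_step[OF p m, of \<omega> k]
    by (simp add: twisted_divisor_count_def algebra_simps)
qed simp

text \<open>
  These sums are the local factors of the twisted divisor count at a prime \<open>p\<close> with \<open>\<omega> p = x\<close>.
\<close>

lemma sum_sign_powers:
  fixes x :: int
  assumes "x \<in> {-1, 0, 1}"
  shows "(\<Sum>j\<le>k. x ^ j) \<ge> 0" "even k \<Longrightarrow> (\<Sum>j\<le>k. x ^ j) \<ge> 1"
    "odd k \<Longrightarrow> x = -1 \<Longrightarrow> (\<Sum>j\<le>k. x ^ j) = 0"
proof -
  have alt: "(\<Sum>j\<le>k. (-1 :: int) ^ j) = (if even k then 1 else 0)" by (induction k) auto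
  have zero: "(\<Sum>j\<le>k. (0 :: int) ^ j) = 1" by (induction k) auto
  show "(\<Sum>j\<le>k. x ^ j) \<ge> 0" "even k \<Longrightarrow> (\<Sum>j\<le>k. x ^ j) \<ge> 1"
    "odd k \<Longrightarrow> x = -1 \<Longrightarrow> (\<Sum>j\<le>k. x ^ j) = 0"
    using assms alt zero by auto
qed

text \<open>
  By multiplicativity both claims reduce to the local factors \<open>1 + x + \<dots> + x ^ k\<close> with
  \<open>x \<in> {-1, 0, 1}\<close>, which are nonnegative, and positive for even \<open>k\<close>.
\<close>

lemma twisted_divisor_count_nonneg:
  assumes \<omega>: "real_character q \<omega>" and "n > 0"
  shows "twisted_divisor_count \<omega> n \<ge> 0 \<and>
         ((\<forall>p. prime p \<longrightarrow> even (multiplicity p n)) \<longrightarrow> twisted_divisor_count \<omega> n \<ge> 1)"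
  using assms(2)
proof (induction n rule: less_induct)
  case (less n)
  show ?case
  proof (cases "n = 1")
    case True
    thus ?thesis by (simp add: twisted_divisor_count_def real_characterD(8)[OF \<omega>, simplified])
  next
    case False
    then obtain p where p: "prime p" "p dvd n" using prime_factor_nat by blast
    define k where "k = multiplicity p n"
    obtain m where m: "n = p ^ k * m" "\<not> p dvd m"
      using multiplicity_decompose'[of n p] less.prems p not_prime_unit unfolding k_def by blast
    have m0: "m > 0" using m(2) by (intro Nat.gr0I) auto
    have "k > 0" unfolding k_def using p less.prems by (simp add: prime_multiplicity_gt_zero_iff)
    hence "m < n" unfolding m(1) using m0 one_less_power[OF prime_gt_1_nat[OF p(1)], of k] \<open>k > 0\<close> by simp
    have mult: "multiplicity l m = multiplicity l n" if "prime l" "l \<noteq> p" for l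
      using that p(1) m0 prime_gt_0_nat[OF p(1)] unfolding m(1)
      by (subst prime_elem_multiplicity_mult_distrib)
         (auto simp: prime_elem_multiplicity_power_distrib prime_multiplicity_other)
    have r: "twisted_divisor_count \<omega> n = (\<Sum>j\<le>k. \<omega> p ^ j) * twisted_divisor_count \<omega> m"
      unfolding m(1) by (rule twisted_divisor_count_prime_power[OF \<omega> p(1) m(2) m0])
    note IH = less.IH[OF \<open>m < n\<close> m0]
    note S = sum_sign_powers[OF real_characterD(3)[OF \<omega>, of p], of k]
    have "twisted_divisor_count \<omega> n \<ge> 1" if "\<forall>p. prime p \<longrightarrow> even (multiplicity p n)"
    proof -
      have "even (multiplicity l m)" if "prime l" for l
        using mult[OF that] \<open>\<forall>p. _\<close> that m(2) by (cases "l = p") (auto simp: not_dvd_imp_multiplicity_0)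
      hence "twisted_divisor_count \<omega> m \<ge> 1" using IH by blast
      moreover have "(\<Sum>j\<le>k. \<omega> p ^ j) \<ge> 1" using S(2) that p(1) unfolding k_def by blast
      ultimately show ?thesis unfolding r using mult_mono[of 1 _ 1] by fastforce
    qed
    thus ?thesis unfolding r using IH S(1) by auto
  qed
qed

lemma twisted_divisor_count_square:
  assumes "real_character q \<omega>" "k > 0"
  shows "twisted_divisor_count \<omega> (k\<^sup>2) \<ge> 1"
  using twisted_divisor_count_nonneg[OF assms(1), of "k\<^sup>2"] assms(2)
  by (auto simp: prime_elem_multiplicity_power_distrib)

lemma twisted_divisor_count_odd_multiplicity:
  assumes \<omega>: "real_character q \<omega>" and n: "twisted_divisor_count \<omega> n \<noteq> 0" "n > 0"
    and p: "prime p" "odd (multiplicity p n)"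
  shows "\<omega> p \<noteq> -1"
proof -
  obtain m where m: "n = p ^ multiplicity p n * m" "\<not> p dvd m"
    using multiplicity_decompose'[of n p] n(2) p(1) not_prime_unit by blast
  have m0: "m > 0" using m(2) by (intro Nat.gr0I) auto
  have "twisted_divisor_count \<omega> n = (\<Sum>j\<le>multiplicity p n. \<omega> p ^ j) * twisted_divisor_count \<omega> m"
    by (subst m(1)) (rule twisted_divisor_count_prime_power[OF \<omega> p(1) m(2) m0])
  thus ?thesis using n(1) p(2) sum_sign_powers(3)[of "\<omega> p" "multiplicity p n"] by auto
qed

text \<open>
  The involution \<open>d \<mapsto> n div d\<close> multiplies \<open>\<omega> d\<close> by \<open>\<omega> n\<close>.
\<close>

lemma twisted_divisor_count_invariant:
  assumes \<omega>: "real_character q \<omega>" and n: "coprime n q"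
  shows "\<omega> n * twisted_divisor_count \<omega> n = twisted_divisor_count \<omega> n"
proof (cases "n = 0")
  case False
  have "\<omega> n * twisted_divisor_count \<omega> n = (\<Sum>d | d dvd n. \<omega> (n div d))"
    unfolding twisted_divisor_count_def sum_distrib_left
  proof (intro sum.cong refl)
    fix d assume "d \<in> {d. d dvd n}"
    then obtain e where e: "n = d * e" by blast
    have "\<omega> d * \<omega> d = 1" using n unfolding e by (intro real_characterD(5)[OF \<omega>]) simp
    hence "\<omega> n * \<omega> d = \<omega> e" unfolding e real_characterD(1)[OF \<omega>] by (simp add: algebra_simps)
    moreover have "n div d = e" using False e by auto
    ultimately show "\<omega> n * \<omega> d = \<omega> (n div d)" by simp
  qed
  also have "\<dots> = twisted_divisor_count \<omega> n" unfolding twisted_divisor_count_def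
    by (rule sum.reindex_bij_witness[of _ "\<lambda>d. n div d" "\<lambda>d. n div d"]) (use False in auto)
  finally show ?thesis .
qed (simp add: twisted_divisor_count_def)

section \<open>Squarefree numbers with prescribed character values\<close>

text \<open>
  The progression \<open>1 + q j\<close> alone makes the sum diverge.
\<close>

lemma coprime_harmonic_unbounded:
  fixes q :: nat and B :: real
  assumes "q > 0"
  shows "\<exists>Y. (\<Sum>k | k \<in> {1..Y} \<and> coprime k q. 1 / real k) > B"
proof (rule ccontr)
  assume "\<not> ?thesis"
  hence bd: "(\<Sum>k | k \<in> {1..Y} \<and> coprime k q. 1 / real k) \<le> B" for Y by (meson not_le)
  have sum_le: "(\<Sum>j<J. 1 / real (1 + q * j)) \<le> B" for J
  proof -
    have "(\<Sum>j<J. 1 / real (1 + q * j)) = (\<Sum>k\<in>(\<lambda>j. 1 + q * j) ` {..<J}. 1 / real k)"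
      using assms by (subst sum.reindex) (auto simp: inj_on_def)
    also have "\<dots> \<le> (\<Sum>k | k \<in> {1..1 + q * J} \<and> coprime k q. 1 / real k)"
    proof (intro sum_mono2)
      show "(\<lambda>j. 1 + q * j) ` {..<J} \<subseteq> {k. k \<in> {1..1 + q * J} \<and> coprime k q}"
      proof
        fix k assume "k \<in> (\<lambda>j. 1 + q * j) ` {..<J}"
        then obtain j where j: "k = 1 + q * j" "j < J" by auto
        have "coprime k q"
        proof (rule coprimeI)
          fix c assume c: "c dvd k" "c dvd q"
          hence "c dvd k - q * j" by (intro dvd_diff_nat dvd_mult2)
          thus "is_unit c" using j(1) by simp
        qed
        thus "k \<in> {k. k \<in> {1..1 + q * J} \<and> coprime k q}" using j by simp
      qed
    qed auto
    also have "\<dots> \<le> B" by (rule bd)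
    finally show ?thesis .
  qed
  have "summable (\<lambda>j. 1 / real (1 + q * j))"
    using sum_le by (intro summableI_nonneg_bounded[of _ B]) auto
  hence "summable (\<lambda>j. real (q + 1) * (1 / real (1 + q * j)))" by (rule summable_mult)
  hence "summable (\<lambda>j. inverse (real j))"
  proof (rule summable_comparison_test[rotated], intro exI allI impI)
    fix j :: nat
    have quotient: "1 / a \<le> c / b" if "0 < a" "0 < b" "b \<le> c * a" for a b c :: real
      using that by (simp add: field_simps)
    show "norm (inverse (real j)) \<le> real (q + 1) * (1 / real (1 + q * j))"
    proof (cases "j = 0")
      case False
      hence "real (1 + q * j) \<le> real ((q + 1) * j)"
        by (intro of_nat_mono) (simp add: algebra_simps)
      hence "1 / real j \<le> real (q + 1) / real (1 + q * j)"
        using False quotient[of "real j" "real (1 + q * j)" "real (q + 1)"]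
        by (simp only: of_nat_mult)
      thus ?thesis by (simp add: inverse_eq_divide)
    qed simp
  qed
  thus False using not_summable_harmonic by blast
qed

text \<open>
  The indicator of the prescribed values \<open>f i n = \<epsilon> i\<close> is, up to a constant factor, the product of the
  \<open>1 + \<epsilon> i * f i n\<close>, which expands into a sum over subsets \<open>S\<close> of \<open>I\<close>. Weight it by \<open>r n / sqrt n\<close>, where
  \<open>r\<close> is the twisted divisor count, and sum over \<open>n \<le> Y\<^sup>2\<close>. The empty set contributes an unbounded positive
  amount. In the first alternative the product \<open>\<psi>\<close> over \<open>S\<close> and \<open>\<omega> \<psi>\<close> are nontrivial characters, so \<open>S\<close>
  contributes a bounded amount. In the second alternative \<open>\<psi> = \<omega>\<close> on units, and since \<open>\<omega> n * r n = r n\<close>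
  the contribution is nonnegative. Hence the total is positive for large \<open>Y\<close>, and some \<open>n\<close> with \<open>r n \<noteq> 0\<close>
  has the prescribed values. Passing to its squarefree part changes no character value, and leaves
  exactly the primes of odd multiplicity, at which \<open>\<omega>\<close> cannot be \<open>-1\<close>.
\<close>

lemma exists_squarefree_with_characters:
  fixes q :: nat and \<omega> :: "nat \<Rightarrow> int" and f :: "'i \<Rightarrow> nat \<Rightarrow> int" and \<epsilon> :: "'i \<Rightarrow> int"
  assumes q: "q > 0" and om: "real_character q \<omega>"
    and I: "finite I" and f: "\<And>i. i \<in> I \<Longrightarrow> real_character q (f i)"
    and eps: "\<And>i. i \<in> I \<Longrightarrow> \<epsilon> i \<in> {1, -1}"
    and alternatives: "\<And>S. S \<subseteq> I \<Longrightarrow> S \<noteq> {} \<Longrightarrow>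
       ((\<exists>u. coprime u q \<and> (\<Prod>i\<in>S. f i u) = -1) \<and> (\<exists>u. coprime u q \<and> \<omega> u * (\<Prod>i\<in>S. f i u) = -1)) \<or>
       ((\<forall>u. coprime u q \<longrightarrow> \<omega> u * (\<Prod>i\<in>S. f i u) = 1) \<and> (\<Prod>i\<in>S. \<epsilon> i) = 1)"
  shows "\<exists>n>0. coprime n q \<and> squarefree n \<and> (\<forall>i\<in>I. f i n = \<epsilon> i) \<and>
           (\<forall>p. prime p \<longrightarrow> p dvd n \<longrightarrow> \<omega> p = 1)"
proof -
  define r where "r = twisted_divisor_count \<omega>"
  have "\<exists>n>0. coprime n q \<and> r n \<noteq> 0 \<and> (\<forall>i\<in>I. f i n = \<epsilon> i)"
  proof (rule ccontr)
    assume none: "\<not> ?thesis"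
    define \<psi> where "\<psi> S n = (if coprime n q then 1 else 0) * (\<Prod>i\<in>S. f i n)" for S n
    define T where "T S Y = (\<Sum>n=1..Y\<^sup>2. real_of_int (\<psi> S n * r n) / sqrt (real n))" for S Y
    define E where "E S = (\<Prod>i\<in>S. \<epsilon> i)" for S
    define C where "C = (2 * real q)\<^sup>2 + 4 * (2 * real q)"
    have C: "C \<ge> 0" unfolding C_def by simp
    have \<psi>: "real_character q (\<psi> S)" if "S \<subseteq> I" for S
      unfolding \<psi>_def using that f by (intro real_character_prod[OF q] finite_subset[OF that I]) blast
    have E_abs: "E S \<in> {1, -1}" if "S \<subseteq> I" for S
    proof -
      have "finite S" using that I finite_subset by blast
      thus ?thesis using that unfolding E_def
      proof (induction S rule: finite_induct)
        case (insert i S)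
        have "\<epsilon> i \<in> {1, -1}" using eps insert.prems by blast
        moreover have "(\<Prod>i\<in>S. \<epsilon> i) \<in> {1, -1}" using insert.IH insert.prems by blast
        ultimately show ?case using insert.hyps by auto
      qed simp
    qed
    have main: "(\<Sum>S\<in>Pow I. real_of_int (E S) * T S Y) = 0" for Y
    proof -
      have zero: "(\<Sum>S\<in>Pow I. E S * (\<psi> S n * r n)) = 0" if "n > 0" for n
      proof (cases "coprime n q \<and> r n \<noteq> 0")
        case True
        have "\<not> (\<forall>i\<in>I. f i n = \<epsilon> i)"
        proof
          assume "\<forall>i\<in>I. f i n = \<epsilon> i"
          hence "\<exists>n>0. coprime n q \<and> r n \<noteq> 0 \<and> (\<forall>i\<in>I. f i n = \<epsilon> i)"
            using that True by (intro exI[of _ n] conjI) simp_all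
          thus False using none by (rule notE[rotated])
        qed
        then obtain i where i: "i \<in> I" "f i n \<noteq> \<epsilon> i" by (meson ballI)
        have "f i n \<in> {1, -1}" using real_characterD(4)[OF f[OF i(1)], of n] True by simp
        \<comment> \<open>A wrong value at one \<open>i\<close> kills the whole product, hence the sum over all subsets.\<close>
        hence vanish: "\<epsilon> i * f i n + 1 = 0" using eps[OF i(1)] i(2) by auto
        have "(\<Prod>i\<in>I. \<epsilon> i * f i n + 1) = 0"
          by (rule prod_zero[OF I]) (use vanish i(1) in \<open>rule bexI\<close>)
        hence "(\<Sum>S\<in>Pow I. E S * (\<Prod>i\<in>S. f i n)) = 0"
          unfolding prod_add[OF I] by (simp add: E_def prod.distrib)
        moreover have "(\<Sum>S\<in>Pow I. E S * (\<psi> S n * r n)) = (\<Sum>S\<in>Pow I. E S * (\<Prod>i\<in>S. f i n)) * r n"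
          unfolding sum_distrib_right \<psi>_def using True by (simp add: mult.assoc)
        ultimately show ?thesis by simp
      next
        case False
        thus ?thesis by (auto simp: \<psi>_def)
      qed
      have "(\<Sum>S\<in>Pow I. real_of_int (E S) * T S Y) =
            (\<Sum>S\<in>Pow I. \<Sum>n=1..Y\<^sup>2. real_of_int (E S * (\<psi> S n * r n)) / sqrt (real n))"
        unfolding T_def sum_distrib_left by simp
      also have "\<dots> = (\<Sum>n=1..Y\<^sup>2. \<Sum>S\<in>Pow I. real_of_int (E S * (\<psi> S n * r n)) / sqrt (real n))"
        by (rule sum.swap)
      also have "\<dots> = (\<Sum>n=1..Y\<^sup>2. real_of_int (\<Sum>S\<in>Pow I. E S * (\<psi> S n * r n)) / sqrt (real n))"
        by (simp add: sum_divide_distrib)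
      also have "\<dots> = 0" using zero by (intro sum.neutral) auto
      finally show ?thesis .
    qed
    have lower: "real_of_int (E S) * T S Y \<ge> - C" if S: "S \<subseteq> I" "S \<noteq> {}" for S Y
    proof (cases "(\<exists>u. coprime u q \<and> (\<Prod>i\<in>S. f i u) = -1) \<and> (\<exists>u. coprime u q \<and> \<omega> u * (\<Prod>i\<in>S. f i u) = -1)")
      case True
      then obtain u v where u: "coprime u q" "\<psi> S u = -1" and v: "coprime v q" "\<omega> v * \<psi> S v = -1"
        unfolding \<psi>_def by auto
      define g where "g n = \<omega> n * \<psi> S n" for n
      have g: "real_character q g" unfolding g_def by (intro real_character_mult om \<psi> S)
      have block: "\<bar>\<Sum>n=a..<b. real_of_int (h n)\<bar> \<le> 2 * real q"
        if "real_character q h" "coprime w q" "h w = -1" for h w a b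
      proof -
        have "real_of_int \<bar>\<Sum>n=a..<b. h n\<bar> \<le> real_of_int (2 * int q)"
          using real_character_block_sum[OF that(1) q that(2,3)] by (simp only: of_int_le_iff)
        thus ?thesis by simp
      qed
      have one: "\<bar>real_of_int (h n)\<bar> \<le> 1" if "real_character q h" for h n
        using real_characterD(7)[OF that, of n] by linarith
      have T: "T S Y = (\<Sum>n=1..Y\<^sup>2. (\<Sum>d | d dvd n. real_of_int (g d) * real_of_int (\<psi> S (n div d))) / sqrt (real n))"
        unfolding T_def
      proof (intro sum.cong refl)
        fix n assume n: "n \<in> {1..Y\<^sup>2}"
        have "\<psi> S n * r n = (\<Sum>d | d dvd n. g d * \<psi> S (n div d))"
          unfolding r_def twisted_divisor_count_def sum_distrib_left
        proof (intro sum.cong refl)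
          fix d assume "d \<in> {d. d dvd n}"
          hence "\<psi> S n = \<psi> S d * \<psi> S (n div d)"
            using real_characterD(1)[OF \<psi>[OF S(1)], of d "n div d"] by simp
          thus "\<psi> S n * \<omega> d = g d * \<psi> S (n div d)" unfolding g_def by simp
        qed
        thus "real_of_int (\<psi> S n * r n) / sqrt (real n) =
          (\<Sum>d | d dvd n. real_of_int (g d) * real_of_int (\<psi> S (n div d))) / sqrt (real n)"
          by simp
      qed
      have "\<bar>T S Y\<bar> \<le> C"
        unfolding T C_def
        using block[OF g v(1)] v(2) block[OF \<psi>[OF S(1)] u] one[OF g] one[OF \<psi>[OF S(1)]]
        by (intro dirichlet_convolution_bound) (simp_all add: g_def)
      thus ?thesis using E_abs[OF S(1)] by (auto simp: abs_le_iff)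
    next
      case False
      hence bad: "\<And>u. coprime u q \<Longrightarrow> \<omega> u * (\<Prod>i\<in>S. f i u) = 1" "E S = 1"
        using alternatives[OF S] unfolding E_def by blast+
      have "\<psi> S n * r n \<ge> 0" if n: "n > 0" for n
      proof (cases "coprime n q")
        case True
        have "\<psi> S n = \<omega> n"
          using bad(1)[OF True] real_characterD(4)[OF om True] True unfolding \<psi>_def by auto
        hence "\<psi> S n * r n = r n"
          using twisted_divisor_count_invariant[OF om True] unfolding r_def by (simp only:)
        moreover have "r n \<ge> 0" using twisted_divisor_count_nonneg[OF om n] unfolding r_def by blast
        ultimately show ?thesis by (simp only:)
      qed (simp add: \<psi>_def)
      hence "T S Y \<ge> 0" unfolding T_def 
        by (intro sum_nonneg divide_nonneg_nonneg) (auto simp del: of_int_mult)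
      thus ?thesis using bad(2) C by simp
    qed
    have trivial: "E {} * T {} Y \<ge> (\<Sum>k | k \<in> {1..Y} \<and> coprime k q. 1 / real k)" for Y
    proof -
      let ?K = "{k. k \<in> {1..Y} \<and> coprime k q}"
      let ?t = "\<lambda>n. real_of_int (\<psi> {} n * r n) / sqrt (real n)"
      have nonneg: "?t n \<ge> 0" if "n > 0" for n
        using twisted_divisor_count_nonneg[OF om that] unfolding \<psi>_def r_def by simp
      have "(\<Sum>k\<in>?K. 1 / real k) \<le> (\<Sum>k\<in>?K. ?t (k\<^sup>2))"
      proof (intro sum_mono)
        fix k assume "k \<in> ?K"
        hence k: "k > 0" "coprime (k\<^sup>2) q" by auto
        thus "1 / real k \<le> ?t (k\<^sup>2)"
          using twisted_divisor_count_square[OF om k(1)] unfolding \<psi>_def r_def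
          by (simp add: divide_right_mono)
      qed
      also have "\<dots> = (\<Sum>n\<in>(\<lambda>k. k\<^sup>2) ` ?K. ?t n)"
        by (subst sum.reindex) (auto simp: inj_on_def)
      also have "\<dots> \<le> T {} Y" unfolding T_def
        by (intro sum_mono2) (use nonneg in \<open>auto simp: power_mono\<close>)
      finally show ?thesis by (simp add: E_def)
    qed
    obtain Y where Y: "(\<Sum>k | k \<in> {1..Y} \<and> coprime k q. 1 / real k) > real (card (Pow I)) * C"
      using coprime_harmonic_unbounded[OF q] by blast
    have "0 = E {} * T {} Y + (\<Sum>S\<in>Pow I - {{}}. real_of_int (E S) * T S Y)"
      using main[of Y] I by (subst (asm) sum.remove[of _ "{}"]) auto
    moreover have "(\<Sum>S\<in>Pow I - {{}}. real_of_int (E S) * T S Y) \<ge> (\<Sum>S\<in>Pow I - {{}}. - C)"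
      by (intro sum_mono lower) auto
    moreover have "real (card (Pow I - {{}})) * C \<le> real (card (Pow I)) * C"
      using C I by (intro mult_right_mono) (auto intro!: card_mono)
    ultimately show False using Y trivial[of Y] by simp
  qed
  then obtain n where n: "n > 0" "coprime n q" "r n \<noteq> 0" "\<And>i. i \<in> I \<Longrightarrow> f i n = \<epsilon> i" by blast
  define N where "N = squarefree_part n"
  define s where "s = square_part n"
  have Ns: "n = N * s\<^sup>2" unfolding N_def s_def by (rule squarefree_decompose)
  have cop: "coprime N q" "coprime s q" using n(1,2) unfolding Ns by auto
  have "f i N = \<epsilon> i" if "i \<in> I" for i
  proof -
    have "f i n = f i N * (f i s * f i s)"
      unfolding Ns power2_eq_square real_characterD(1)[OF f[OF that]] ..
    thus ?thesis using n(4)[OF that] real_characterD(5)[OF f[OF that] cop(2)] by simp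
  qed
  moreover have "\<omega> p = 1" if p: "prime p" "p dvd N" for p
  proof -
    have "multiplicity p N > 0" using p n(1) unfolding Ns by (simp add: prime_multiplicity_gt_zero_iff)
    hence "odd (multiplicity p n)" using prime_multiplicity_squarefree_part[OF p(1), of n]
      unfolding N_def by presburger
    hence "\<omega> p \<noteq> -1" using twisted_divisor_count_odd_multiplicity[OF om _ n(1) p(1)] n(3) unfolding r_def by blast
    moreover have "coprime p q" using cop(1) p(2) by (metis coprime_divisors dvd_refl)
    ultimately show ?thesis using real_characterD(4)[OF om] by blast
  qed
  moreover have "squarefree N" unfolding N_def by simp
  moreover have "N > 0" using n(1) Ns by (intro Nat.gr0I) simp
  ultimately show ?thesis using cop(1) by blast
qed

section \<open>Legendre symbols and quadratic reciprocity\<close>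

lemma Legendre_values: "Legendre a p \<in> {-1, 0, 1}"
  by (auto simp: Legendre_def)

lemma Legendre_eq_0_iff: "Legendre a p = 0 \<longleftrightarrow> p dvd a"
  by (auto simp: Legendre_def cong_0_iff)

lemma Legendre_cong: "[a = b] (mod p) \<Longrightarrow> Legendre a p = Legendre b p"
  unfolding Legendre_def QuadRes_def by (simp add: cong_def)

lemma Legendre_1: "prime (p :: nat) \<Longrightarrow> Legendre 1 (int p) = 1"
  using QuadRes_def[of "int p" 1] prime_gt_1_nat[of p]
  by (auto simp: Legendre_def cong_0_iff intro: exI[of _ 1])

text \<open>
  This turns congruences between Legendre symbols, as given by Euler's criterion, into equalities.
\<close>

lemma sign_eq_of_cong:
  fixes x y p :: int
  assumes "[x = y] (mod p)" "p > 2" "x \<in> {-1, 0, 1}" "y \<in> {-1, 0, 1}"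
  shows "x = y"
proof (rule ccontr)
  assume "x \<noteq> y"
  moreover have "p dvd x - y" using assms(1) by (simp add: cong_iff_dvd_diff)
  ultimately have "\<bar>p\<bar> \<le> \<bar>x - y\<bar>" by (intro dvd_imp_le_int) auto
  thus False using assms(2-4) by auto
qed

lemma Legendre_mult:
  assumes p: "prime (p :: nat)" "p > 2"
  shows "Legendre (a * b) (int p) = Legendre a (int p) * Legendre b (int p)"
proof -
  have "[Legendre (a * b) (int p) = a ^ ((p - 1) div 2) * b ^ ((p - 1) div 2)] (mod int p)"
    using euler_criterion[OF p, of "a * b"] by (simp add: power_mult_distrib)
  moreover have "[Legendre a (int p) * Legendre b (int p)
                    = a ^ ((p - 1) div 2) * b ^ ((p - 1) div 2)] (mod int p)"
    by (intro cong_mult euler_criterion p)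
  ultimately have "[Legendre (a * b) (int p) = Legendre a (int p) * Legendre b (int p)] (mod int p)"
    using cong_sym cong_trans by blast
  thus ?thesis using p(2) Legendre_values[of a "int p"] Legendre_values[of b "int p"]
    by (intro sign_eq_of_cong[of _ _ "int p"] Legendre_values) auto
qed

lemma Legendre_prod:
  assumes p: "prime (p :: nat)" "p > 2"
  shows "Legendre (\<Prod>i\<in>I. f i) (int p) = (\<Prod>i\<in>I. Legendre (f i) (int p))"
  by (induction I rule: infinite_finite_induct) (simp_all add: Legendre_1 Legendre_mult p)

text \<open>
  The two characters of conductor 4 and 8 that give the Legendre symbols of \<open>-1\<close> and of \<open>2\<close>.
\<close>

definition chi4 :: "nat \<Rightarrow> int" where
  "chi4 n = (if n mod 4 = 1 then 1 else if n mod 4 = 3 then -1 else 0)"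

definition chi8 :: "nat \<Rightarrow> int" where
  "chi8 n = (if n mod 8 = 1 \<or> n mod 8 = 7 then 1 else if n mod 8 = 3 \<or> n mod 8 = 5 then -1 else 0)"

lemma mod4_cases: "n mod 4 = 0 \<or> n mod 4 = 1 \<or> n mod 4 = 2 \<or> n mod 4 = (3::nat)"
  by linarith

lemma mod8_cases: "n mod 8 = 0 \<or> n mod 8 = 1 \<or> n mod 8 = 2 \<or> n mod 8 = 3 \<or>
    n mod 8 = 4 \<or> n mod 8 = 5 \<or> n mod 8 = 6 \<or> n mod 8 = (7::nat)"
  by linarith

lemma chi4_mult: "chi4 (a * b) = chi4 a * chi4 b"
proof -
  have "(a * b) mod 4 = ((a mod 4) * (b mod 4)) mod 4" by (simp add: mod_mult_eq)
  thus ?thesis using mod4_cases[of a] mod4_cases[of b] unfolding chi4_def by (elim disjE) simp_all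
qed

lemma chi8_mult: "chi8 (a * b) = chi8 a * chi8 b"
proof -
  have "(a * b) mod 8 = ((a mod 8) * (b mod 8)) mod 8" by (simp add: mod_mult_eq)
  thus ?thesis using mod8_cases[of a] mod8_cases[of b] unfolding chi8_def by (elim disjE) simp_all
qed

lemma Legendre_minus_one:
  assumes p: "prime (p :: nat)" "p > 2"
  shows "Legendre (-1) (int p) = chi4 p"
proof -
  have odd: "odd p" using p prime_odd_nat by auto
  have "chi4 p = (-1) ^ ((p - 1) div 2)"
  proof (cases "p mod 4 = 1")
    case True
    then obtain k where "p = 4 * k + 1" by (metis mult_div_mod_eq)
    thus ?thesis by (simp add: chi4_def)
  next
    case False
    hence m: "p mod 4 = 3" using odd by presburger
    then obtain k where "p = 4 * k + 3" by (metis mult_div_mod_eq)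
    hence "(p - 1) div 2 = 2 * k + 1" by simp
    thus ?thesis using m by (simp add: chi4_def)
  qed
  hence "[Legendre (-1) (int p) = chi4 p] (mod int p)" using euler_criterion[OF p, of "-1"] by simp
  thus ?thesis using p(2) by (intro sign_eq_of_cong[of _ _ "int p"] Legendre_values) (simp_all add: chi4_def)
qed

text \<open>
  The second supplement, by the lemma of Gauss: with \<open>h = (p - 1) / 2\<close>, the number of \<open>x\<close> in \<open>{1..h}\<close>
  for which \<open>2 x\<close> exceeds \<open>h\<close> is \<open>h - h div 2\<close>.
\<close>

lemma Legendre_two:
  assumes p: "prime (p :: nat)" "p > 2"
  shows "Legendre 2 (int p) = chi8 p"
proof -
  have odd: "odd p" using p prime_odd_nat by auto
  interpret G: GAUSS p 2
    using p by unfold_locales (auto simp: cong_0_iff dest: zdvd_imp_le)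
  define h where "h = (int p - 1) div 2"
  have h: "int p = 2 * h + 1" "h > 0" using odd p(2) unfolding h_def by (auto elim!: oddE)
  have "G.E = (\<lambda>x. x * 2) ` {h div 2 <.. h}"
  proof -
    have "G.C = (\<lambda>x. x * 2) ` {0 <.. h}"
      unfolding G.C_def G.B_def G.A_def h_def[symmetric] image_image
      by (intro image_cong refl mod_pos_pos_trivial) (use h in auto)
    thus ?thesis unfolding G.E_def h_def[symmetric] by (auto simp: image_iff)
  qed
  hence "card G.E = card {h div 2 <.. h}" by (simp add: card_image inj_on_def)
  hence c: "card G.E = nat (h - h div 2)" by simp
  have "Legendre 2 (int p) = (-1) ^ nat (h - h div 2)" using G.gauss_lemma c by simp
  moreover have "(-1) ^ nat (h - h div 2) = chi8 p"
  proof -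
    define k where "k = nat h"
    have pk: "p = 2 * k + 1" and hk: "h = int k" using h unfolding k_def by auto
    have "nat (h - h div 2) = k - k div 2" unfolding hk
      by (metis nat_int of_nat_diff div_le_dividend zdiv_int of_nat_numeral)
    moreover have "even (k - k div 2) \<longleftrightarrow> p mod 8 = 1 \<or> p mod 8 = 7"
    proof -
      define j where "j = k div 4"
      consider "k = 4 * j" | "k = 4 * j + 1" | "k = 4 * j + 2" | "k = 4 * j + 3"
        unfolding j_def by linarith
      thus ?thesis
      proof cases
        case 1
        have "p = 8 * j + 1" "k - k div 2 = 2 * j" using 1 pk by presburger+
        thus ?thesis by simp
      next
        case 2
        have "p = 8 * j + 3" "k - k div 2 = 2 * j + 1" using 2 pk by presburger+
        thus ?thesis by simp
      next
        case 3
        have "p = 8 * j + 5" "k - k div 2 = 2 * j + 1" using 3 pk by presburger+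
        thus ?thesis by simp
      next
        case 4
        have "p = 8 * j + 7" "k - k div 2 = 2 * (j + 1)" using 4 pk by presburger+
        thus ?thesis by simp
      qed
    qed
    moreover have "p mod 8 = 1 \<or> p mod 8 = 3 \<or> p mod 8 = 5 \<or> p mod 8 = 7" using odd by presburger
    ultimately show ?thesis unfolding chi8_def by (cases "even (k - k div 2)") auto
  qed
  ultimately show ?thesis by simp
qed

text \<open>
  The sign \<open>(-1) ^ ((p - 1) / 2 * ((l - 1) / 2))\<close>, written so that it is multiplicative in \<open>p\<close> for fixed \<open>l\<close>.
\<close>

lemma Legendre_reciprocity:
  assumes p: "prime (p :: nat)" "p > 2" and l: "prime (l :: nat)" "l > 2" and "p \<noteq> l"
  shows "Legendre (int p) (int l) = (if l mod 4 = 1 then 1 else chi4 p) * Legendre (int l) (int p)"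
proof -
  have "odd p" "odd l" using p l prime_odd_nat by auto
  have qr: "Legendre (int p) (int l) * Legendre (int l) (int p) = (-1) ^ ((p - 1) div 2 * ((l - 1) div 2))"
    using Quadratic_Reciprocity[OF p l assms(5)] .
  have sign: "(-1 :: int) ^ ((p - 1) div 2 * ((l - 1) div 2)) = (if l mod 4 = 1 then 1 else chi4 p)"
  proof -
    have e: "even ((n - 1) div 2) \<longleftrightarrow> n mod 4 = 1" if "odd n" for n :: nat
      using that by presburger
    have "p mod 4 = 1 \<or> p mod 4 = 3" using \<open>odd p\<close> by presburger
    thus ?thesis using e[OF \<open>odd p\<close>] e[OF \<open>odd l\<close>]
      by (auto simp: chi4_def minus_one_power_iff)
  qed
  have "Legendre (int l) (int p) \<in> {1, -1}"
  proof -
    have "\<not> p dvd l" using p l assms(5) by (metis not_prime_1 primes_dvd_imp_eq)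
    hence "Legendre (int l) (int p) \<noteq> 0" by (simp add: Legendre_eq_0_iff)
    thus ?thesis using Legendre_values[of "int l" "int p"] by auto
  qed
  thus ?thesis using qr unfolding sign by auto
qed

text \<open>
  The Chinese remainder theorem, applied to one prime factor after the other.
\<close>

lemma QuadRes_squarefree:
  fixes n :: nat and a :: int
  assumes "squarefree n" "\<And>p. prime p \<Longrightarrow> p dvd n \<Longrightarrow> QuadRes (int p) a"
  shows "QuadRes (int n) a"
  using assms
proof (induction n rule: less_induct)
  case (less n)
  show ?case
  proof (cases "n = 1")
    case False
    then obtain p where p: "prime p" "p dvd n" using prime_factor_nat by blast
    then obtain m where m: "n = p * m" by blast
    have "\<not> p dvd m"
    proof
      assume "p dvd m"
      hence "p\<^sup>2 dvd n" unfolding m power2_eq_square by simp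
      thus False using less.prems(1) p(1) squarefreeD not_prime_unit by blast
    qed
    hence cop: "coprime p m" using p(1) prime_imp_coprime by blast
    have "squarefree m" using less.prems(1) squarefree_mono[of m n] unfolding m by simp
    have "m < n" using p(1) less.prems(1) prime_gt_1_nat[OF p(1)] unfolding m by (cases "m = 0") auto
    hence "QuadRes (int m) a" using less.IH[of m] \<open>squarefree m\<close> less.prems(2) m by auto
    then obtain x where x: "[x\<^sup>2 = a] (mod int m)" unfolding QuadRes_def by blast
    obtain y where y: "[y\<^sup>2 = a] (mod int p)" using less.prems(2)[OF p] unfolding QuadRes_def by blast
    have "coprime (int p) (int m)" using cop by simp
    then obtain z where "[z = y] (mod int p)" "[z = x] (mod int m)"
      using binary_chinese_remainder_int by blast
    hence "[z\<^sup>2 = a] (mod int p)" "[z\<^sup>2 = a] (mod int m)"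
      using x y cong_pow cong_trans by blast+
    hence "[z\<^sup>2 = a] (mod int p * int m)"
      using \<open>coprime (int p) (int m)\<close> by (intro coprime_cong_mult)
    thus ?thesis unfolding QuadRes_def m by auto
  qed (auto simp: QuadRes_def)
qed

section \<open>Squarefree numbers with prescribed Legendre symbols\<close>

lemma real_character_restrict:
  assumes "q > 0" "\<And>a b. g (a * b) = g a * g b" "\<And>a. g (a mod q) = g a"
    and "\<And>a. coprime a q \<Longrightarrow> g a \<in> {1, -1}"
  shows "real_character q (\<lambda>n. if coprime n q then g n else 0)"
  unfolding real_character_def using assms by (auto simp: coprime_mod_left_iff)

text \<open>
  Otherwise squaring would permute the nonzero residues, but \<open>1\<close> and \<open>p - 1\<close> have the same square.
\<close>

lemma exists_nonresidue:
  assumes p: "prime (p :: nat)" "p > 2"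
  shows "\<exists>x :: nat. Legendre (int x) (int p) = -1"
proof (rule ccontr)
  assume none: "\<not> ?thesis"
  let ?A = "{1..<p}" and ?f = "\<lambda>y. y\<^sup>2 mod p"
  have sub: "?A \<subseteq> ?f ` ?A"
  proof
    fix x assume x: "x \<in> ?A"
    hence "\<not> int p dvd int x" by (auto dest: zdvd_imp_le)
    hence "Legendre (int x) (int p) = 1"
      using none Legendre_values[of "int x" "int p"] Legendre_eq_0_iff[of "int x" "int p"] by auto
    hence "QuadRes (int p) (int x)" by (auto simp: Legendre_def split: if_splits)
    then obtain y where y: "[y\<^sup>2 = int x] (mod int p)" unfolding QuadRes_def by blast
    define z where "z = nat (y mod int p)"
    have z: "int z = y mod int p" unfolding z_def using p by simp
    hence "[(int z)\<^sup>2 = int x] (mod int p)" using y by (simp add: cong_def power_mod)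
    hence "[z\<^sup>2 = x] (mod p)" by (metis cong_int_iff of_nat_power)
    hence zx: "z\<^sup>2 mod p = x" using x by (simp add: cong_def)
    have "int z < int p" unfolding z using p by simp
    moreover have "z \<noteq> 0" using zx x by (intro notI) simp
    ultimately show "x \<in> ?f ` ?A" using zx by (intro image_eqI[of _ _ z]) auto
  qed
  have inj: "inj_on ?f ?A"
  proof (rule eq_card_imp_inj_on)
    have "card ?A \<le> card (?f ` ?A)" by (intro card_mono sub) simp
    thus "card (?f ` ?A) = card ?A" using card_image_le[of ?A ?f] by simp
  qed simp
  have eq: "?f 1 = ?f (p - 1)"
  proof -
    obtain k where k: "p = k + 2" using p(2) by (metis add.commute less_imp_add_positive)
    have "(p - 1)\<^sup>2 = k * p + 1" unfolding k by (simp add: power2_eq_square algebra_simps)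
    hence "(p - 1)\<^sup>2 mod p = 1 mod p" by (simp only: mod_mult_self3)
    thus ?thesis by simp
  qed
  have "1 = p - 1" by (rule inj_onD[OF inj eq]) (use p in auto)
  thus False using p by simp
qed

text \<open>
  The Chinese remainder theorem makes the residue modulo 8 and the Legendre symbols at distinct odd primes
  independent of each other.
\<close>

lemma exists_legendre_pattern:
  fixes P :: "nat set" and \<sigma> :: "nat \<Rightarrow> int" and a :: nat
  assumes P: "finite P" "\<And>p. p \<in> P \<Longrightarrow> prime p \<and> p > 2"
    and \<sigma>: "\<And>p. p \<in> P \<Longrightarrow> \<sigma> p \<in> {1, -1}" and a: "odd a"
  shows "\<exists>u. coprime u (8 * \<Prod>P) \<and> u mod 8 = a mod 8 \<and> (\<forall>p\<in>P. Legendre (int u) (int p) = \<sigma> p)"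
proof -
  have "\<exists>x :: nat. Legendre (int x) (int p) = \<sigma> p" if p: "p \<in> P" for p
  proof (cases "\<sigma> p = 1")
    case True
    thus ?thesis using Legendre_1[of p] P(2)[OF p] by (intro exI[of _ 1]) simp
  next
    case False
    thus ?thesis using exists_nonresidue[of p] P(2)[OF p] \<sigma>[OF p] by auto
  qed
  then obtain x :: "nat \<Rightarrow> nat" where x: "\<And>p. p \<in> P \<Longrightarrow> Legendre (int (x p)) (int p) = \<sigma> p" by metis
  have cop8: "coprime (8 :: nat) p" if "p \<in> P" for p
  proof -
    have "odd p" using P(2)[OF that] prime_odd_nat by auto
    hence "coprime (2 ^ 3) p" by (intro coprime_power_left_iff[THEN iffD2]) simp
    thus ?thesis by simp
  qed
  have "\<forall>i\<in>insert 8 P. \<forall>j\<in>insert 8 P. i \<noteq> j \<longrightarrow> coprime i j"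
    using cop8 P(2) by (auto simp: primes_coprime coprime_commute)
  then obtain u where u: "\<And>i. i \<in> insert 8 P \<Longrightarrow> [u = (if i = 8 then a else x i)] (mod i)"
    using chinese_remainder_nat[of "insert 8 P" "\<lambda>i. i" "\<lambda>i. if i = 8 then a else x i"] P(1) by blast
  have leg: "Legendre (int u) (int p) = \<sigma> p" if p: "p \<in> P" for p
  proof -
    have "p \<noteq> 8" using cop8[OF p] by auto
    hence "[int u = int (x p)] (mod int p)" using u[of p] p by (simp add: cong_int_iff)
    thus ?thesis using Legendre_cong x[OF p] by metis
  qed
  have u8: "u mod 8 = a mod 8" using u[of 8] by (simp add: cong_def)
  have "odd u" using u8 a by presburger
  hence "coprime u (2 ^ 3)" by (intro coprime_power_right_iff[THEN iffD2]) simp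
  moreover have "coprime u p" if p: "p \<in> P" for p
  proof -
    have "\<not> int p dvd int u" using leg[OF p] \<sigma>[OF p] Legendre_eq_0_iff[of "int u" "int p"] by auto
    thus ?thesis using P(2)[OF p] by (metis coprime_commute prime_imp_coprime int_dvd_int_iff)
  qed
  ultimately have "coprime u (8 * \<Prod>P)" by (auto intro: prod_coprime_right)
  thus ?thesis using leg u8 by blast
qed

text \<open>
  The part modulo 8 of the character \<open>(-m / n)\<close>, where \<open>m\<close> is \<open>w\<close> or \<open>2 w\<close> with \<open>w\<close> odd, and \<open>e\<close> tells whether
  \<open>m\<close> is even. The squares in the remaining cases are the trivial character modulo 2; they make the
  values vanish at even \<open>n\<close> in every case.
\<close>

definition dyadic_character :: "bool \<Rightarrow> nat \<Rightarrow> nat \<Rightarrow> int" where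
  "dyadic_character e w n = (if w mod 4 = 1 then chi4 n else (chi4 n)\<^sup>2) * (if e then chi8 n else (chi8 n)\<^sup>2)"

lemma chi4_chi8_odd:
  assumes "odd n"
  shows "chi4 n \<in> {1, -1}" "chi8 n \<in> {1, -1}"
proof -
  have "n mod 4 = 1 \<or> n mod 4 = 3" using assms by presburger
  thus "chi4 n \<in> {1, -1}" unfolding chi4_def by auto
  have "n mod 8 = 1 \<or> n mod 8 = 3 \<or> n mod 8 = 5 \<or> n mod 8 = 7" using assms by presburger
  thus "chi8 n \<in> {1, -1}" unfolding chi8_def by auto
qed

lemma dyadic_character_values: "odd n \<Longrightarrow> dyadic_character e w n \<in> {1, -1}"
  using chi4_chi8_odd[of n] unfolding dyadic_character_def by auto

lemma dyadic_character_mult: "dyadic_character e w (a * b) = dyadic_character e w a * dyadic_character e w b"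
  unfolding dyadic_character_def by (simp add: chi4_mult chi8_mult power_mult_distrib)

lemma dyadic_character_mod: "8 dvd q \<Longrightarrow> dyadic_character e w (a mod q) = dyadic_character e w a"
proof -
  assume q: "8 dvd q"
  have "a mod q mod 8 = a mod 8" using q by (simp add: mod_mod_cancel)
  moreover have "4 dvd q" using q dvd_trans[of 4 8 q] by simp
  hence "a mod q mod 4 = a mod 4" by (simp add: mod_mod_cancel)
  ultimately show ?thesis unfolding dyadic_character_def chi4_def chi8_def by simp
qed

text \<open>
  Apply \<open>exists_squarefree_with_characters\<close> to the Legendre symbols at the primes in \<open>P\<close> and to their
  product \<open>\<omega>\<close> with the dyadic character, which equals \<open>(-m / l)\<close> at odd primes \<open>l\<close> by reciprocity. A nonempty
  product of Legendre symbols at distinct primes is nontrivial. Multiplied by \<open>\<omega>\<close>, the product over \<open>S\<close>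
  leaves the dyadic character times the product over the complement of \<open>S\<close>. This is trivial only if \<open>S = P\<close>
  and the dyadic character is trivial, which happens for \<open>m\<close> congruent to 3 modulo 4; then \<open>\<omega> N\<close> is
  the product of the prescribed symbols, whence the condition that this product be 1.
\<close>

lemma exists_squarefree_legendre_pattern:
  fixes P :: "nat set" and e :: bool and \<sigma> :: "nat \<Rightarrow> int" and m w :: nat
  assumes P: "finite P" "\<And>p. p \<in> P \<Longrightarrow> prime p \<and> p > 2"
    and w: "w = \<Prod>P" and m: "m = (if e then 2 else 1) * w"
    and \<sigma>: "\<And>p. p \<in> P \<Longrightarrow> \<sigma> p \<in> {1, -1}"
    and product: "m mod 4 = 3 \<Longrightarrow> (\<Prod>p\<in>P. \<sigma> p) = 1"
  shows "\<exists>N>0. squarefree N \<and> coprime N (8 * w) \<and> (\<forall>p\<in>P. Legendre (int N) (int p) = \<sigma> p) \<and>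
           QuadRes (int N) (- int m)"
proof -
  define q where "q = 8 * w"
  define L where "L p n = (if coprime n q then Legendre (int n) (int p) else 0)" for p n
  define \<omega> where "\<omega> n = (if coprime n q then dyadic_character e w n * (\<Prod>p\<in>P. Legendre (int n) (int p)) else 0)" for n
  have oddP: "odd p" if "p \<in> P" for p using P(2)[OF that] prime_odd_nat by auto
  have w_odd: "odd w" unfolding w using P(1) oddP by (simp add: even_prod_iff)
  have q0: "q > 0" unfolding q_def w using P by (auto intro!: prod_pos simp: prime_gt_0_nat)
  have pq: "p dvd q" if "p \<in> P" for p unfolding q_def w using dvd_prodI[OF P(1) that, of "\<lambda>p. p"] by simp
  have odd_if: "odd n" if "coprime n q" for n
    using that unfolding q_def by (metis coprime_common_divisor dvd_mult2 even_numeral odd_one)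
  have Lval: "Legendre (int n) (int p) \<in> {1, -1}" if n: "coprime n q" and p: "p \<in> P" for n p
  proof -
    have "\<not> p dvd n"
    proof
      assume "p dvd n"
      hence "is_unit p" using coprime_common_divisor[OF n] pq[OF p] by blast
      thus False using P(2)[OF p] by simp
    qed
    hence "Legendre (int n) (int p) \<noteq> 0" by (simp add: Legendre_eq_0_iff)
    thus ?thesis using Legendre_values[of "int n" "int p"] by auto
  qed
  have Lmod: "Legendre (int (n mod q)) (int p) = Legendre (int n) (int p)" if "p \<in> P" for n p
  proof -
    have "[n mod q = n] (mod p)" using pq[OF that] by (simp add: cong_def mod_mod_cancel)
    hence "[int (n mod q) = int n] (mod int p)" by (simp only: cong_int_iff)
    thus ?thesis by (rule Legendre_cong)
  qed
  have prodval: "(\<Prod>p\<in>S. Legendre (int n) (int p)) \<in> {1, -1}" if n: "coprime n q" and S: "S \<subseteq> P" for n S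
  proof -
    have "finite S" using S P(1) finite_subset by blast
    thus ?thesis using S
    proof (induction S rule: finite_induct)
      case (insert i S)
      have "Legendre (int n) (int i) \<in> {1, -1}" using Lval[OF n] insert.prems by simp
      moreover have "(\<Prod>p\<in>S. Legendre (int n) (int p)) \<in> {1, -1}" using insert.IH insert.prems by simp
      ultimately show ?case using insert.hyps by auto
    qed simp
  qed
  have L: "real_character q (L p)" if p: "p \<in> P" for p
    unfolding L_def using Lval[OF _ p] Lmod[OF p] Legendre_mult[of p] P(2)[OF p]
    by (intro real_character_restrict q0) simp_all
  have om: "real_character q \<omega>"
    unfolding \<omega>_def
  proof (rule real_character_restrict[OF q0])
    fix a b
    have "(\<Prod>p\<in>P. Legendre (int (a * b)) (int p)) =
          (\<Prod>p\<in>P. Legendre (int a) (int p) * Legendre (int b) (int p))"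
      by (intro prod.cong refl) (use P(2) Legendre_mult in auto)
    thus "dyadic_character e w (a * b) * (\<Prod>p\<in>P. Legendre (int (a * b)) (int p)) =
          dyadic_character e w a * (\<Prod>p\<in>P. Legendre (int a) (int p)) *
          (dyadic_character e w b * (\<Prod>p\<in>P. Legendre (int b) (int p)))"
      by (simp add: dyadic_character_mult prod.distrib mult_ac)
  next
    fix a
    have "8 dvd q" unfolding q_def by simp
    thus "dyadic_character e w (a mod q) * (\<Prod>p\<in>P. Legendre (int (a mod q)) (int p)) =
      dyadic_character e w a * (\<Prod>p\<in>P. Legendre (int a) (int p))"
      using Lmod by (simp add: dyadic_character_mod)
  next
    fix a assume a: "coprime a q"
    show "dyadic_character e w a * (\<Prod>p\<in>P. Legendre (int a) (int p)) \<in> {1, -1}"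
      using dyadic_character_values[OF odd_if[OF a], of e w] prodval[OF a subset_refl] by auto
  qed
  have pattern: "\<exists>u. coprime u q \<and> u mod 8 = a mod 8 \<and> (\<forall>p\<in>P. Legendre (int u) (int p) = (if p \<in> D then -1 else 1))"
    if "odd a" for a D
    unfolding q_def w by (rule exists_legendre_pattern[OF P _ that]) auto
  have not_e: "\<not> e" if "m mod 4 = 3"
  proof
    assume e
    hence "even m" using m by simp
    thus False using that by presburger
  qed
  have single: "(\<Prod>p\<in>S. if p \<in> {p0} then -1 else (1 :: int)) = (if p0 \<in> S then -1 else 1)"
    if "S \<subseteq> P" for S p0
    using finite_subset[OF that P(1)] by (simp add: prod.delta)
  have "\<exists>n>0. coprime n q \<and> squarefree n \<and> (\<forall>p\<in>P. L p n = \<sigma> p) \<and>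
           (\<forall>l. prime l \<longrightarrow> l dvd n \<longrightarrow> \<omega> l = 1)"
  proof (rule exists_squarefree_with_characters[OF q0 om P(1) L \<sigma>])
    fix S assume S: "S \<subseteq> P" "S \<noteq> {}"
    have split: "\<omega> u * (\<Prod>p\<in>S. L p u) = dyadic_character e w u * (\<Prod>p\<in>P - S. Legendre (int u) (int p))"
      if u: "coprime u q" for u
    proof -
      have "(\<Prod>p\<in>P. Legendre (int u) (int p)) =
            (\<Prod>p\<in>P - S. Legendre (int u) (int p)) * (\<Prod>p\<in>S. Legendre (int u) (int p))"
        by (rule prod.subset_diff[OF S(1) P(1)])
      moreover have "(\<Prod>p\<in>S. L p u) = (\<Prod>p\<in>S. Legendre (int u) (int p))" using u by (simp add: L_def)
      ultimately show ?thesis using prodval[OF u S(1)] u by (auto simp: \<omega>_def)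
    qed
    show "((\<exists>u. coprime u q \<and> (\<Prod>i\<in>S. L i u) = -1) \<and> (\<exists>u. coprime u q \<and> \<omega> u * (\<Prod>i\<in>S. L i u) = -1)) \<or>
       ((\<forall>u. coprime u q \<longrightarrow> \<omega> u * (\<Prod>i\<in>S. L i u) = 1) \<and> (\<Prod>i\<in>S. \<sigma> i) = 1)"
    proof (cases "m mod 4 = 3 \<and> S = P")
      case True
      have "\<not> e" using True not_e by blast
      hence "dyadic_character e w u = 1" if "coprime u q" for u
        using True m chi4_chi8_odd[OF odd_if[OF that]] unfolding dyadic_character_def by auto
      hence "\<forall>u. coprime u q \<longrightarrow> \<omega> u * (\<Prod>i\<in>S. L i u) = 1" using split True by simp
      thus ?thesis using product True by blast
    next
      case False
      obtain p0 where p0: "p0 \<in> S" using S(2) by blast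
      obtain u where u: "coprime u q" "\<And>p. p \<in> P \<Longrightarrow> Legendre (int u) (int p) = (if p \<in> {p0} then -1 else 1)"
        using pattern[of 1 "{p0}"] by auto
      have "(\<Prod>i\<in>S. L i u) = (\<Prod>p\<in>S. if p \<in> {p0} then -1 else (1 :: int))"
        using u S(1) by (intro prod.cong refl) (auto simp: L_def)
      hence first: "(\<Prod>i\<in>S. L i u) = -1" using single[OF S(1)] p0 by simp
      have "\<exists>v. coprime v q \<and> dyadic_character e w v * (\<Prod>p\<in>P - S. Legendre (int v) (int p)) = -1"
      proof (cases "m mod 4 = 3")
        case True
        then obtain p1 where p1: "p1 \<in> P - S" using False S(1) by blast
        obtain v where v: "coprime v q" "\<And>p. p \<in> P \<Longrightarrow> Legendre (int v) (int p) = (if p \<in> {p1} then -1 else 1)"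
          using pattern[of 1 "{p1}"] by auto
        have "\<not> e" using True not_e by blast
        hence "dyadic_character e w v = 1"
          using True m chi4_chi8_odd[OF odd_if[OF v(1)]] unfolding dyadic_character_def by auto
        moreover have "(\<Prod>p\<in>P - S. Legendre (int v) (int p)) = (\<Prod>p\<in>P - S. if p \<in> {p1} then -1 else (1 :: int))"
          using v by (intro prod.cong refl) auto
        ultimately show ?thesis using v(1) p1 single[of "P - S" p1] by auto
      next
        case False
        \<comment> \<open>The dyadic character is nontrivial here, and \<open>a\<close> is a residue at which it is \<open>-1\<close>.\<close>
        define a :: nat where "a = (if e then 5 else 3)"
        have "odd a" unfolding a_def by simp
        then obtain v where v: "coprime v q" "v mod 8 = a mod 8" "\<And>p. p \<in> P \<Longrightarrow> Legendre (int v) (int p) = 1"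
          using pattern[of a "{}"] by auto
        have "dyadic_character e w v = dyadic_character e w a" using dyadic_character_mod[of 8 e w v] dyadic_character_mod[of 8 e w a] v(2) by simp
        also have "dyadic_character e w a = -1"
        proof (cases e)
          case True
          thus ?thesis unfolding dyadic_character_def a_def chi4_def chi8_def by simp
        next
          case e: False
          hence "w mod 4 = 1" using False m w_odd by simp presburger
          thus ?thesis using e unfolding dyadic_character_def a_def chi4_def chi8_def by simp
        qed
        finally show ?thesis using v by (intro exI[of _ v]) simp
      qed
      then obtain v where v: "coprime v q" "dyadic_character e w v * (\<Prod>p\<in>P - S. Legendre (int v) (int p)) = -1" by blast
      thus ?thesis using first u(1) split[OF v(1)] by metis
    qed
  qed
  then obtain N where N: "N > 0" "coprime N q" "squarefree N" "\<And>p. p \<in> P \<Longrightarrow> L p N = \<sigma> p"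
    "\<And>l. prime l \<Longrightarrow> l dvd N \<Longrightarrow> \<omega> l = 1" by blast
  have "QuadRes (int N) (- int m)"
  proof (rule QuadRes_squarefree[OF N(3)])
    fix l assume l: "prime l" "l dvd N"
    have lq: "coprime l q" using N(2) l(2) coprime_divisors[of l N q q] by simp
    have l2: "l > 2" using odd_if[OF lq] prime_ge_2_nat[OF l(1)] by (metis even_numeral le_neq_implies_less)
    have "- int m = (-1) * ((if e then 2 else 1) * (\<Prod>p\<in>P. int p))" unfolding m w by simp
    also have "Legendre \<dots> (int l) =
        Legendre (-1) (int l) * (Legendre (if e then 2 else 1) (int l) * (\<Prod>p\<in>P. Legendre (int p) (int l)))"
      by (simp only: Legendre_mult[OF l(1) l2] Legendre_prod[OF l(1) l2])
    also have "(\<Prod>p\<in>P. Legendre (int p) (int l)) =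
        (\<Prod>p\<in>P. (if l mod 4 = 1 then 1 else chi4 p) * Legendre (int l) (int p))"
    proof (intro prod.cong refl Legendre_reciprocity l l2)
      fix p assume p: "p \<in> P"
      show "prime p" "p > 2" using P(2)[OF p] by auto
      show "p \<noteq> l" using coprime_common_divisor[OF lq, of p] pq[OF p] P(2)[OF p] by auto
    qed
    also have "\<dots> = (if l mod 4 = 1 then 1 else chi4 w) * (\<Prod>p\<in>P. Legendre (int l) (int p))"
    proof -
      have "chi4 (\<Prod>P) = (\<Prod>p\<in>P. chi4 p)"
        by (induction P rule: infinite_finite_induct) (simp_all add: chi4_mult, simp_all add: chi4_def)
      thus ?thesis by (simp add: prod.distrib w)
    qed
    also have "Legendre (-1) (int l) = chi4 l" by (rule Legendre_minus_one[OF l(1) l2])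
    also have "Legendre (if e then 2 else 1) (int l) = (if e then chi8 l else (chi8 l)\<^sup>2)"
      using Legendre_two[OF l(1) l2] Legendre_1[OF l(1)] chi4_chi8_odd[OF odd_if[OF lq]] by auto
    also have "chi4 l * ((if e then chi8 l else (chi8 l)\<^sup>2) *
                 ((if l mod 4 = 1 then 1 else chi4 w) * (\<Prod>p\<in>P. Legendre (int l) (int p)))) = \<omega> l"
    proof -
      have "w mod 4 = 1 \<or> w mod 4 = 3" using w_odd by presburger
      moreover have "l mod 4 = 1 \<or> l mod 4 = 3" using odd_if[OF lq] by presburger
      ultimately have "chi4 l * (if l mod 4 = 1 then 1 else chi4 w) = (if w mod 4 = 1 then chi4 l else (chi4 l)\<^sup>2)"
        unfolding chi4_def by auto
      thus ?thesis using lq unfolding \<omega>_def dyadic_character_def by (simp add: mult_ac)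
    qed
    also have "\<omega> l = 1" using N(5) l by blast
    finally show "QuadRes (int l) (- int m)" by (auto simp: Legendre_def split: if_splits)
  qed
  moreover have "Legendre (int N) (int p) = \<sigma> p" if "p \<in> P" for p
    using N(4)[OF that] N(2) by (simp add: L_def)
  ultimately show ?thesis using N unfolding q_def by blast
qed

section \<open>The theorem of Legendre and Gauss on three squares\<close>

lemma squarefree_eq_prod_prime_factors:
  fixes w :: nat
  assumes "squarefree w"
  shows "w = \<Prod>(prime_factors w)"
proof -
  have w: "w \<noteq> 0" using assms by (intro notI) simp
  have "multiplicity p w = 1" if "p \<in> prime_factors w" for p
    using assms w that squarefree_factorial_semiring'[OF w] by blast
  hence "(\<Prod>p\<in>prime_factors w. p ^ multiplicity p w) = (\<Prod>p\<in>prime_factors w. p)"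
    by (intro prod.cong) auto
  thus ?thesis using prime_factorization_nat[of w] w by simp
qed

lemma QuadRes_2: "QuadRes 2 a"
  unfolding QuadRes_def by (rule exI[of _ a]) (simp add: cong_iff_dvd_diff power2_eq_square)

text \<open>
  With \<open>B = c N\<close>, the number \<open>-B\<close> is a square modulo an odd prime \<open>p\<close> dividing \<open>m\<close> exactly if \<open>N\<close> and \<open>-c\<close> have the
  same Legendre symbol at \<open>p\<close>. If \<open>m\<close> is congruent to 3 modulo 4, the product of these symbols over the
  primes dividing \<open>m\<close> has to be 1. For \<open>c = 1\<close> it would be the Jacobi symbol \<open>(-1 / m) = -1\<close>, whereas for
  \<open>c = 2\<close> it is \<open>(-2 / m)\<close>, which is 1 if \<open>m\<close> is congruent to 3 modulo 8.
\<close>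

lemma three_squares_squarefree:
  fixes m :: nat
  assumes sqf: "squarefree m" and m: "m mod 4 = 1 \<or> m mod 4 = 2 \<or> m mod 8 = 3"
  shows "\<exists>u v w :: int. int m = u\<^sup>2 + v\<^sup>2 + w\<^sup>2"
proof -
  define e where "e \<longleftrightarrow> even m"
  define w where "w = (if e then m div 2 else m)"
  have mw: "m = (if e then 2 else 1) * w" unfolding w_def e_def by auto
  have w_odd: "odd w" unfolding w_def e_def using m by presburger
  have m0: "m > 0" using sqf by (intro Nat.gr0I) simp
  have "squarefree w" using squarefree_mono[OF _ sqf, of w] mw by simp
  define P where "P = prime_factors w"
  have w: "w = \<Prod>P" unfolding P_def by (rule squarefree_eq_prod_prime_factors) fact
  have P: "finite P" "\<And>p. p \<in> P \<Longrightarrow> prime p \<and> p > 2"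
  proof -
    show "finite P" unfolding P_def by simp
    fix p assume "p \<in> P"
    hence p: "prime p" "p dvd w" unfolding P_def by auto
    have "p \<noteq> 2" using p(2) w_odd by auto
    thus "prime p \<and> p > 2" using p(1) prime_ge_2_nat[OF p(1)] by simp
  qed
  define c :: nat where "c = (if m mod 4 = 3 then 2 else 1)"
  define \<sigma> where "\<sigma> p = Legendre (- int c) (int p)" for p
  have \<sigma>: "\<sigma> p \<in> {1, -1}" if p: "p \<in> P" for p
  proof -
    have "\<not> int p dvd - int c"
      using P(2)[OF p] unfolding c_def by (auto dest: zdvd_imp_le)
    thus ?thesis unfolding \<sigma>_def
      using Legendre_values[of "- int c" "int p"] Legendre_eq_0_iff[of "- int c" "int p"] by auto
  qed
  have product: "(\<Prod>p\<in>P. \<sigma> p) = 1" if m3: "m mod 4 = 3"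
  proof -
    have m8: "m mod 8 = 3" using m m3 by simp
    have "odd m" using m3 by presburger
    hence "w = m" using mw unfolding e_def by simp
    have "\<sigma> p = chi4 p * chi8 p" if "p \<in> P" for p
      using P(2)[OF that] Legendre_mult[of p "-1" 2] Legendre_minus_one[of p] Legendre_two[of p] m3
      unfolding \<sigma>_def c_def by simp
    hence "(\<Prod>p\<in>P. \<sigma> p) = (\<Prod>p\<in>P. chi4 p * chi8 p)" by simp
    also have "\<dots> = chi4 (\<Prod>P) * chi8 (\<Prod>P)"
      using P(1) by (induction P rule: finite_induct)
        (simp_all add: chi4_mult chi8_mult, simp add: chi4_def chi8_def)
    also have "\<dots> = 1" unfolding w[symmetric] \<open>w = m\<close> chi4_def chi8_def using m3 m8 by simp
    finally show ?thesis .
  qed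
  obtain N where N: "N > 0" "squarefree N" "coprime N (8 * w)"
    "\<And>p. p \<in> P \<Longrightarrow> Legendre (int N) (int p) = \<sigma> p" "QuadRes (int N) (- int m)"
    using exists_squarefree_legendre_pattern[OF P w mw \<sigma> product] by blast
  have N_odd: "odd N" using N(3) by (metis coprime_common_divisor dvd_mult2 even_numeral odd_one)
  have "coprime N m" using N(3) coprime_divisors[of N N m "8 * w"] mw by (cases e) auto
  moreover have "coprime c m"
    using m unfolding c_def by (auto simp: coprime_left_2_iff_odd) presburger+
  ultimately have cop: "coprime (c * N) m" by simp
  have "QuadRes (int (c * N)) (- int m)"
  proof (rule QuadRes_squarefree)
    show "squarefree (c * N)" using N(2) N_odd unfolding c_def
      by (auto intro!: squarefree_mult_coprime simp: squarefree_prime)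
    fix p assume p: "prime p" "p dvd c * N"
    show "QuadRes (int p) (- int m)"
    proof (cases "p = 2")
      case False
      have "p dvd c \<longrightarrow> p = 2" using p(1) primes_dvd_imp_eq[of p 2] unfolding c_def by auto
      hence "int p dvd int N" using p False by (auto simp: prime_dvd_mult_iff)
      thus ?thesis using N(5) unfolding QuadRes_def by (meson cong_dvd_modulus)
    qed (simp add: QuadRes_2)
  qed
  moreover have "QuadRes (int m) (- int (c * N))"
  proof (rule QuadRes_squarefree[OF sqf])
    fix p assume p: "prime p" "p dvd m"
    show "QuadRes (int p) (- int (c * N))"
    proof (cases "p = 2")
      case False
      have "p dvd w" using p False mw primes_dvd_imp_eq[of p 2]
        by (auto simp: prime_dvd_mult_iff split: if_splits)
      moreover have "w \<noteq> 0" using w_odd by (intro notI) simp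
      ultimately have pP: "p \<in> P" unfolding P_def using p(1) by (simp add: in_prime_factors_iff)
      have "Legendre (- int c * int N) (int p) = \<sigma> p * \<sigma> p"
        using Legendre_mult[of p "- int c" "int N"] P(2)[OF pP] N(4)[OF pP] unfolding \<sigma>_def by simp
      also have "\<dots> = 1" using \<sigma>[OF pP] by auto
      finally show ?thesis by (auto simp: Legendre_def split: if_splits)
    qed (simp add: QuadRes_2)
  qed
  moreover have "int (c * N) > 0" using N(1) unfolding c_def by simp
  moreover have "coprime (int (c * N)) (int m)" using cop by (simp only: coprime_int_iff)
  ultimately show ?thesis using m0 by (intro three_squares_of_mutual_residues) auto
qed

lemma odd_square_eq:
  fixes x :: "'a :: semiring_parity"
  assumes "odd x"
  shows "\<exists>j. x\<^sup>2 = 8 * j + 1"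
proof -
  obtain k where k: "x = 2 * k + 1" using assms by (elim oddE)
  obtain j where j: "k * (k + 1) = 2 * j" by (metis evenE even_mult_iff even_plus_one_iff)
  have "x\<^sup>2 = 4 * (k * (k + 1)) + 1" unfolding k
    by (simp add: power2_sum power_mult_distrib distrib_left power2_eq_square[of k]
        mult.assoc[symmetric] add_ac)
  hence "x\<^sup>2 = 8 * j + 1" unfolding j by (simp add: mult.assoc[symmetric])
  thus ?thesis by blast
qed

text \<open>
  Odd squares are 1 modulo 8 and \<open>4\<close> does not divide \<open>m\<close>, so the squarefree part of \<open>m\<close> lies in the same
  residue class modulo 8.
\<close>

theorem sum_of_three_squares:
  fixes m :: nat
  assumes m: "m mod 4 = 1 \<or> m mod 4 = 2 \<or> m mod 8 = 3"
  shows "\<exists>u v w :: int. int m = u\<^sup>2 + v\<^sup>2 + w\<^sup>2"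
proof -
  define f s where "f = squarefree_part m" and "s = square_part m"
  have fs: "m = f * s\<^sup>2" unfolding f_def s_def by (rule squarefree_decompose)
  have "odd s"
  proof
    assume "even s"
    hence "2 * 2 dvd s * s" by (intro mult_dvd_mono)
    hence "4 dvd s\<^sup>2" by (simp add: power2_eq_square)
    hence "4 dvd m" unfolding fs by simp
    thus False using m by presburger
  qed
  then obtain j where s8: "s\<^sup>2 = 8 * j + 1" using odd_square_eq by blast
  have "m = f + 8 * (f * j)" unfolding fs s8 by (simp add: algebra_simps)
  hence m8: "m mod 8 = f mod 8" by simp
  have "m mod 4 = f mod 4" using m8 mod_mod_cancel[of 4 8 m] mod_mod_cancel[of 4 8 f] by simp
  hence "f mod 4 = 1 \<or> f mod 4 = 2 \<or> f mod 8 = 3" using m m8 by simp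
  then obtain u v w :: int where "int f = u\<^sup>2 + v\<^sup>2 + w\<^sup>2"
    using three_squares_squarefree[of f] unfolding f_def by auto
  hence "int m = (int s * u)\<^sup>2 + (int s * v)\<^sup>2 + (int s * w)\<^sup>2"
    unfolding fs by (simp add: power_mult_distrib algebra_simps)
  thus ?thesis by blast
qed


section \<open>The sum spectrum\<close>

lemma square_mod_8_odd: "odd (x :: int) \<Longrightarrow> x\<^sup>2 mod 8 = 1"
  using odd_square_eq[of x] by auto

lemma square_mod_4: "(x :: int)\<^sup>2 mod 4 = (if even x then 0 else 1)"
proof (cases "even x")
  case False
  have "x\<^sup>2 mod 4 = x\<^sup>2 mod 8 mod 4" by (simp add: mod_mod_cancel)
  thus ?thesis using square_mod_8_odd[OF False] False by simp
qed (auto elim!: evenE simp: power2_eq_square)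

text \<open>
  The matrix \<open>1/2\<close> times \<open>((1,1,1,1), (1,1,-1,-1), (1,-1,1,-1), (1,-1,-1,1))\<close> is orthogonal, symmetric
  and hence its own inverse; the parity conditions make half of its image of \<open>(T, x, y, z)\<close> integral.
\<close>

lemma half_sum_representation:
  fixes T x y z n :: int
  assumes "T\<^sup>2 + x\<^sup>2 + y\<^sup>2 + z\<^sup>2 = 4 * n"
    and "4 dvd T + x + y + z" "even (x + y)" "even (x + z)" "even (y + z)"
  shows "\<exists>a b c d. a\<^sup>2 + b\<^sup>2 + c\<^sup>2 + d\<^sup>2 = n \<and> a + b + c + d = T"
proof -
  obtain a where a: "T + x + y + z = 4 * a" using assms(2) by blast
  obtain p q r where p: "y + z = 2 * p" and q: "x + z = 2 * q" and r: "x + y = 2 * r"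
    using assms(3-5) by (elim evenE) blast
  have eq: "T = 4 * a - p - q - r" "x = q + r - p" "y = p + r - q" "z = p + q - r"
    using a p q r by linarith+
  have "4 * (a\<^sup>2 + (a - p)\<^sup>2 + (a - q)\<^sup>2 + (a - r)\<^sup>2) = T\<^sup>2 + x\<^sup>2 + y\<^sup>2 + z\<^sup>2"
    unfolding eq by (simp add: power2_eq_square algebra_simps)
  hence "a\<^sup>2 + (a - p)\<^sup>2 + (a - q)\<^sup>2 + (a - r)\<^sup>2 = n" using assms(1) by simp
  moreover have "a + (a - p) + (a - q) + (a - r) = T" using eq(1) by simp
  ultimately show ?thesis by blast
qed

text \<open>
  In a representation as a sum of squares, \<open>x, y, z\<close> are all odd because \<open>4 n - T\<^sup>2\<close> is 3 modulo 4. So \<open>T + x + y + z\<close> is even, and if it is not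
  divisible by 4, replacing \<open>x\<close> by \<open>-x\<close> changes it by 2 modulo 4.
\<close>

lemma sum_spectrum_odd:
  fixes n T :: int
  assumes "odd n" "odd T" "T\<^sup>2 \<le> 4 * n"
  shows "T \<in> sum_spectrum n"
proof -
  have T8: "T\<^sup>2 mod 8 = 1" using assms(2) by (rule square_mod_8_odd)
  define m where "m = nat (4 * n - T\<^sup>2)"
  have m: "int m = 4 * n - T\<^sup>2" unfolding m_def using assms(3) by simp
  have "int m mod 8 = 3" unfolding m using T8 assms(1) by presburger
  hence "m mod 8 = 3" by presburger
  then obtain x y z :: int where xyz: "int m = x\<^sup>2 + y\<^sup>2 + z\<^sup>2" using sum_of_three_squares by blast
  have "odd x \<and> odd y \<and> odd z"
  proof -
    have "int m mod 4 = 3" using \<open>int m mod 8 = 3\<close> by presburger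
    hence "(x\<^sup>2 + y\<^sup>2 + z\<^sup>2) mod 4 = 3" unfolding xyz .
    moreover have "(x\<^sup>2 + y\<^sup>2 + z\<^sup>2) mod 4 = ((x\<^sup>2 + y\<^sup>2) mod 4 + z\<^sup>2 mod 4) mod 4"
      by (rule mod_add_eq[symmetric])
    moreover have "(x\<^sup>2 + y\<^sup>2) mod 4 = (x\<^sup>2 mod 4 + y\<^sup>2 mod 4) mod 4"
      by (rule mod_add_eq[symmetric])
    ultimately show ?thesis unfolding square_mod_4 by (auto split: if_splits)
  qed
  hence odd: "odd x" "odd y" "odd z" by auto
  have "\<exists>x'. x'\<^sup>2 = x\<^sup>2 \<and> odd x' \<and> 4 dvd T + x' + y + z"
  proof (cases "4 dvd T + x + y + z")
    case False
    \<comment> \<open>Both this sum and \<open>2 x\<close> are 2 modulo 4, so their difference is divisible by 4.\<close>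
    have "even (T + x + y + z)" using odd assms(2) by simp
    then obtain k where k: "T + x + y + z = 2 * k" by (elim evenE)
    obtain l where l: "x = 2 * l + 1" using odd(1) by (elim oddE)
    have "odd k" using False k by (auto elim!: evenE)
    then obtain j where j: "k = 2 * j + 1" by (elim oddE)
    have "T + (- x) + y + z = 2 * k - 2 * x" using k by simp
    also have "\<dots> = 4 * (j - l)" unfolding l j by simp
    finally have "4 dvd T + (- x) + y + z" by simp
    thus ?thesis using odd by (intro exI[of _ "- x"]) simp
  qed (use odd in blast)
  then obtain x' where x': "x'\<^sup>2 = x\<^sup>2" "odd x'" "4 dvd T + x' + y + z" by blast
  have "T\<^sup>2 + x'\<^sup>2 + y\<^sup>2 + z\<^sup>2 = 4 * n" using m xyz x'(1) by simp
  from half_sum_representation[OF this x'(3)] odd x'(2)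
  show ?thesis unfolding sum_spectrum_def by (simp, metis)
qed

text \<open>
  A representation of \<open>4 n - T\<^sup>2\<close> by even numbers \<open>2 x, 2 y, 2 z\<close> is used, where \<open>n = (T / 2)\<^sup>2 + x\<^sup>2 + y\<^sup>2 + z\<^sup>2\<close>. As \<open>n\<close> is
  even, so is \<open>T / 2 + x + y + z\<close>.
\<close>

lemma sum_spectrum_twice_odd:
  fixes n T :: int
  assumes n: "n mod 4 = 2" and "even T" "T\<^sup>2 \<le> 4 * n"
  shows "T \<in> sum_spectrum n"
proof -
  obtain t where t: "T = 2 * t" using assms(2) by (elim evenE)
  have le: "t\<^sup>2 \<le> n" using assms(3) unfolding t by (simp add: power_mult_distrib)
  define m where "m = nat (n - t\<^sup>2)"
  have m: "int m = n - t\<^sup>2" unfolding m_def using le by simp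
  have "int m mod 4 = 1 \<or> int m mod 4 = 2"
    unfolding m using square_mod_4[of t] n by (cases "even t"; simp; presburger)
  hence "m mod 4 = 1 \<or> m mod 4 = 2" by presburger
  then obtain x y z :: int where xyz: "int m = x\<^sup>2 + y\<^sup>2 + z\<^sup>2" using sum_of_three_squares by blast
  have sum: "n = t\<^sup>2 + x\<^sup>2 + y\<^sup>2 + z\<^sup>2" using m xyz by simp
  have "even n" using n by presburger
  hence "even (t + x + y + z)" unfolding sum by simp
  hence "4 dvd T + 2 * x + 2 * y + 2 * z" unfolding t by presburger
  moreover have "T\<^sup>2 + (2 * x)\<^sup>2 + (2 * y)\<^sup>2 + (2 * z)\<^sup>2 = 4 * n"
    unfolding t sum by (simp add: power_mult_distrib)
  ultimately show ?thesis
    using half_sum_representation[of T "2 * x" "2 * y" "2 * z" n]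
    unfolding sum_spectrum_def by (simp, metis)
qed

lemma sum_spectrum_bound:
  fixes n T :: int
  assumes "T \<in> sum_spectrum n"
  shows "[T = n] (mod 2)" "T\<^sup>2 \<le> 4 * n"
proof -
  obtain a b c d where abcd: "T = a + b + c + d" "a\<^sup>2 + b\<^sup>2 + c\<^sup>2 + d\<^sup>2 = n"
    using assms unfolding sum_spectrum_def by blast
  have "even (T - n)" unfolding abcd(1) abcd(2)[symmetric] by simp
  thus "[T = n] (mod 2)" by (simp add: cong_iff_dvd_diff)
  have "4 * n - T\<^sup>2 = (a + b - c - d)\<^sup>2 + (a - b + c - d)\<^sup>2 + (a - b - c + d)\<^sup>2"
    unfolding abcd(1) abcd(2)[symmetric] by (simp add: power2_eq_square algebra_simps)
  moreover have "\<dots> \<ge> 0" by simp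
  ultimately show "T\<^sup>2 \<le> 4 * n" by linarith
qed

lemma abs_le_two_sqrt_iff:
  "real_of_int \<bar>T\<bar> \<le> 2 * sqrt (real n) \<longleftrightarrow> T\<^sup>2 \<le> 4 * int n"
proof -
  have "2 * sqrt (real n) = sqrt (real_of_int (4 * int n))" by (simp add: real_sqrt_mult)
  moreover have "real_of_int \<bar>T\<bar> = sqrt (real_of_int (T\<^sup>2))" by simp
  ultimately show ?thesis by (simp only: real_sqrt_le_iff of_int_le_iff)
qed

theorem proposition3:
  fixes n :: nat
  assumes "\<not> 4 dvd n"
  shows "sum_spectrum (int n) =
    {T :: int. [T = int n] (mod 2) \<and> real_of_int \<bar>T\<bar> \<le> 2 * sqrt (real n)}"
proof (intro equalityI subsetI CollectI)
  fix T assume "T \<in> sum_spectrum (int n)"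
  thus "[T = int n] (mod 2) \<and> real_of_int \<bar>T\<bar> \<le> 2 * sqrt (real n)"
    using sum_spectrum_bound unfolding abs_le_two_sqrt_iff by blast
next
  fix T assume "T \<in> {T. [T = int n] (mod 2) \<and> real_of_int \<bar>T\<bar> \<le> 2 * sqrt (real n)}"
  hence T: "even T \<longleftrightarrow> even n" "T\<^sup>2 \<le> 4 * int n"
    unfolding abs_le_two_sqrt_iff by (auto simp: cong_iff_dvd_diff)
  show "T \<in> sum_spectrum (int n)"
  proof (cases "odd n")
    case True
    thus ?thesis using T by (intro sum_spectrum_odd) auto
  next
    case False
    hence "int n mod 4 = 2" using assms by presburger
    thus ?thesis using T False by (intro sum_spectrum_twice_odd) auto
  qed
qed

end
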